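(* Let $X$ be a squared $\kappa$-$\mu$ shadowed random variable with mean $\bar\gamma>0$ and shape parameters $\kappa,\mu,m$, and let $\hat X$ be a squared $\kappa$-$\mu$ shadowed random variable with mean $\widetilde\gamma>0$ and shape parameters $\hat\kappa,\hat\mu,\hat m$, where $\kappa,\hat\kappa$ are arbitrary non-negative real numbers and $\mu,m,\hat\mu,\hat m$ are positive integers. Assume $X$ and $\hat X$ are independent (not necessarily identically distributed). Let $M,(C_j,m_j,\Omega_j)_{0\le j\le M}$ be the mixture parameters associated with $(\bar\gamma,\kappa,\mu,m)$, and $\hat M,(\hat C_h,\hat m_h,\hat\Omega_h)_{0\le h\le\hat M}$ those associated with $(\widetilde\gamma,\hat\kappa,\hat\mu,\hat m)$. Then $Z=X\hat X$ is distributed as a finite mixture of Gamma-Gamma distributions, with probability density function, for $z>0$, $$f_Z(z)=\sum_{j=0}^{M}\sum_{h=0}^{\hat M} C_j\hat C_h\,\frac{2\,z^{\frac{m_j+\hat m_h}{2}-1}}{\Gamma(m_j)\Gamma(\hat m_h)\,(\Omega_j\hat\Omega_h)^{\frac{m_j+\hat m_h}{2}}}\,K_{m_j-\hat m_h}\!\left(\sqrt{\frac{4z}{\Omega_j\hat\Omega_h}}\right),$$ where $K_\nu$ is the modified Bessel function of the second kind.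
   Context: Squared $\kappa$-$\mu$ shadowed distribution: a positive random variable $\gamma$ is a squared $\kappa$-$\mu$ shadowed random variable with mean $\bar\gamma>0$ and shape parameters $\kappa\ge 0$, $\mu>0$, $m>0$ if it has density, for $x>0$, $$f(x)=\frac{\mu^\mu m^m(1+\kappa)^\mu}{\Gamma(\mu)\,\bar\gamma\,(\mu\kappa+m)^m}\left(\frac{x}{\bar\gamma}\right)^{\mu-1}e^{-\frac{\mu(1+\kappa)x}{\bar\gamma}}\;{}_1F_1\!\left(m;\mu;\frac{\mu^2\kappa(1+\kappa)}{\mu\kappa+m}\frac{x}{\bar\gamma}\right),$$ where ${}_1F_1$ is the Kummer confluent hypergeometric function. Gamma-Gamma distribution: the distribution of the product of two independent Gamma-distributed (squared Nakagami-$m$) random variables. The factor multiplying $C_j\hat C_h$ in the formula is the density of the product of two independent Gamma variables with densities $x^{m_j-1}e^{-x/\Omega_j}/(\Omega_j^{m_j}(m_j-1)!)$ and $x^{\hat m_h-1}e^{-x/\hat\Omega_h}/(\hat\Omega_h^{\hat m_h}(\hat m_h-1)!)$. Mixture parameters associated with $(\bar\gamma,\kappa,\mu,m)$ ($\mu,m$ positive integers): put $p=\frac{m}{\mu\kappa+m}$, $q=\frac{\mu\kappa}{\mu\kappa+m}$, $\Delta_1=\frac{\bar\gamma}{\mu(1+\kappa)}$, $\Delta_2=\frac{\mu\kappa+m}{m}\cdot\frac{\bar\gamma}{\mu(1+\kappa)}$. Case $\mu>m$: $M=\mu$, and - for $i=0$: $C_0=0$, $m_0=\mu-m+1$, $\Omega_0=\Delta_1$;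 - for $0<i\le\mu-m$: $C_i=(-1)^m\binom{m+i-2}{i-1}p^{m}q^{-m-i+1}$, $m_i=\mu-m-i+1$, $\Omega_i=\Delta_1$; - for $\mu-m<i\le\mu$: $C_i=(-1)^{i-\mu+m-1}\binom{i-2}{i-\mu+m-1}p^{\,i-\mu+m-1}q^{-i+1}$, $m_i=\mu-i+1$, $\Omega_i=\Delta_2$. Case $\mu\le m$: $M=m-\mu$, and for $0\le i\le M$: $C_i=\binom{m-\mu}{i}p^{i}q^{\,m-\mu-i}$ (with $0^0=1$), $m_i=m-i$, $\Omega_i=\Delta_2$. The hatted parameters $\hat M,\hat C_h,\hat m_h,\hat\Omega_h$ are obtained by the same formulas with $(\bar\gamma,\kappa,\mu,m)$ replaced by $(\widetilde\gamma,\hat\kappa,\hat\mu,\hat m)$.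
   Formalization: When κ=0 and μ>m (or the hatted analogue) the weights contain 0 to a negative power, so the formula is undefined; there the density of Z is shown to be the limit of the formula through positive κ, κ̂, and no mixture weights are asserted. *)

theory Defs
  imports "HOL-Probability.Probability"
begin

text \<open>
  A real random variable with a pointwise nonnegative Lebesgue density. The nonnegativity makes
  the coercion to \<^typ>\<open>ennreal\<close>, which sends negative reals to 0, harmless.
\<close>
definition has_pdf :: "'a measure \<Rightarrow> ('a \<Rightarrow> real) \<Rightarrow> (real \<Rightarrow> real) \<Rightarrow> bool" where
  "has_pdf M X f \<longleftrightarrow> (\<forall>x. 0 \<le> f x) \<and> distributed M lborel X (\<lambda>x. ennreal (f x))"

definition kummer_1F1 :: "real \<Rightarrow> real \<Rightarrow> real \<Rightarrow> real" where
  "kummer_1F1 a b x = (\<Sum>n. pochhammer a n / pochhammer b n * x ^ n / fact n)"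

text \<open>
  Modified Bessel function of the second kind, of real order and positive argument, by its
  classical integral representation. Unlike the quotient
  $\pi (I_{-\nu}(x) - I_\nu(x)) / (2 \sin (\nu\pi))$, it needs no limit at the integer orders,
  which are the ones used here.
\<close>
definition bessel_K :: "real \<Rightarrow> real \<Rightarrow> real" where
  "bessel_K \<nu> x = (LBINT t:{0..}. exp (- x * cosh t) * cosh (\<nu> * t))"

definition kms_density :: "real \<Rightarrow> real \<Rightarrow> real \<Rightarrow> real \<Rightarrow> real \<Rightarrow> real" where
  "kms_density g \<kappa> \<mu> m x =
     (if x > 0
      then \<mu> powr \<mu> * m powr m * (1 + \<kappa>) powr \<mu> / (Gamma \<mu> * g * (\<mu> * \<kappa> + m) powr m)
           * (x / g) powr (\<mu> - 1) * exp (- (\<mu> * (1 + \<kappa>) * x / g))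
           * kummer_1F1 m \<mu> (\<mu>\<^sup>2 * \<kappa> * (1 + \<kappa>) / (\<mu> * \<kappa> + m) * (x / g))
      else 0)"

text \<open>Squared $\kappa$-$\mu$ shadowed random variable with mean \<open>g\<close>.\<close>
definition squared_kms :: "'a measure \<Rightarrow> ('a \<Rightarrow> real) \<Rightarrow> real \<Rightarrow> real \<Rightarrow> real \<Rightarrow> real \<Rightarrow> bool" where
  "squared_kms M X g \<kappa> \<mu> m \<longleftrightarrow>
     g > 0 \<and> \<kappa> \<ge> 0 \<and> \<mu> > 0 \<and> m > 0 \<and> has_pdf M X (kms_density g \<kappa> \<mu> m)"

text \<open>
  Mixture parameters. All subtractions on \<^typ>\<open>nat\<close> below are exact on the index ranges where
  they are used; to this end the exponent $i - \mu + m - 1$ is written \<^term>\<open>i + m - \<mu> - (1::nat)\<close>.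
  For \<^prop>\<open>m < \<mu>\<close> the weights contain negative powers of \<open>mix_q\<close>, so they are meaningful only
  if \<^prop>\<open>\<kappa> \<noteq> (0::real)\<close>. The weights may be negative.
\<close>
definition mix_p :: "real \<Rightarrow> nat \<Rightarrow> nat \<Rightarrow> real" where
  "mix_p \<kappa> \<mu> m = m / (\<mu> * \<kappa> + m)"

definition mix_q :: "real \<Rightarrow> nat \<Rightarrow> nat \<Rightarrow> real" where
  "mix_q \<kappa> \<mu> m = \<mu> * \<kappa> / (\<mu> * \<kappa> + m)"

definition mix_Delta1 :: "real \<Rightarrow> real \<Rightarrow> nat \<Rightarrow> nat \<Rightarrow> real" where
  "mix_Delta1 g \<kappa> \<mu> m = g / (\<mu> * (1 + \<kappa>))"

definition mix_Delta2 :: "real \<Rightarrow> real \<Rightarrow> nat \<Rightarrow> nat \<Rightarrow> real" where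
  "mix_Delta2 g \<kappa> \<mu> m = (\<mu> * \<kappa> + m) / m * (g / (\<mu> * (1 + \<kappa>)))"

definition mix_M :: "nat \<Rightarrow> nat \<Rightarrow> nat" where
  "mix_M \<mu> m = (if m < \<mu> then \<mu> else m - \<mu>)"

definition mix_C :: "real \<Rightarrow> nat \<Rightarrow> nat \<Rightarrow> nat \<Rightarrow> real" where
  "mix_C \<kappa> \<mu> m i =
     (let p = mix_p \<kappa> \<mu> m; q = mix_q \<kappa> \<mu> m in
      if m < \<mu> then
        (if i = 0 then 0
         else if i \<le> \<mu> - m then
           (-1) ^ m * real ((m + i - 2) choose (i - 1)) * p ^ m * q powi (- int m - int i + 1)
         else
           (-1) ^ (i + m - \<mu> - 1) * real ((i - 2) choose (i + m - \<mu> - 1))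
             * p ^ (i + m - \<mu> - 1) * q powi (- int i + 1))
      else real ((m - \<mu>) choose i) * p ^ i * q ^ (m - \<mu> - i))"

definition mix_shape :: "nat \<Rightarrow> nat \<Rightarrow> nat \<Rightarrow> nat" where
  "mix_shape \<mu> m i =
     (if m < \<mu> then
        (if i = 0 then \<mu> - m + 1
         else if i \<le> \<mu> - m then \<mu> - m - i + 1
         else \<mu> - i + 1)
      else m - i)"

definition mix_Omega :: "real \<Rightarrow> real \<Rightarrow> nat \<Rightarrow> nat \<Rightarrow> nat \<Rightarrow> real" where
  "mix_Omega g \<kappa> \<mu> m i =
     (if m < \<mu> \<and> i \<le> \<mu> - m then mix_Delta1 g \<kappa> \<mu> m else mix_Delta2 g \<kappa> \<mu> m)"

text \<open>
  \<^term>\<open>erlang_density (a - 1) (1 / v)\<close> is the Gamma density with integer shape \<open>a\<close> and scale \<open>v\<close>: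
  the first argument of \<^const>\<open>erlang_density\<close> is the shape minus one, the second is the rate.
\<close>
definition gamma_gamma :: "nat \<Rightarrow> real \<Rightarrow> nat \<Rightarrow> real \<Rightarrow> real measure" where
  "gamma_gamma a v b w =
     distr (density lborel (erlang_density (a - 1) (1 / v)) \<Otimes>\<^sub>M
            density lborel (erlang_density (b - 1) (1 / w)))
       borel (\<lambda>(x, y). x * y)"

definition gamma_gamma_density :: "nat \<Rightarrow> real \<Rightarrow> nat \<Rightarrow> real \<Rightarrow> real \<Rightarrow> real" where
  "gamma_gamma_density a v b w z =
     2 * z powr ((real a + real b) / 2 - 1)
       / (Gamma (real a) * Gamma (real b) * (v * w) powr ((real a + real b) / 2))
       * bessel_K (real a - real b) (sqrt (4 * z / (v * w)))"

text \<open>Finite mixture of laws on the reals; negative weights are allowed.\<close>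
definition finite_mixture ::
  "'i set \<Rightarrow> ('i \<Rightarrow> real) \<Rightarrow> ('i \<Rightarrow> real measure) \<Rightarrow> real measure \<Rightarrow> bool" where
  "finite_mixture I w G N \<longleftrightarrow>
     finite I \<and> sum w I = 1 \<and> (\<forall>i\<in>I. prob_space (G i)) \<and>
     (\<forall>A\<in>sets borel. measure N A = (\<Sum>i\<in>I. w i * measure (G i) A))"

text \<open>The double sum giving the density of the product at \<open>z > 0\<close>.\<close>
definition product_mixture ::
  "real \<Rightarrow> real \<Rightarrow> nat \<Rightarrow> nat \<Rightarrow> real \<Rightarrow> real \<Rightarrow> nat \<Rightarrow> nat \<Rightarrow> real \<Rightarrow> real" where
  "product_mixture g \<kappa> \<mu> m g' \<kappa>' \<mu>' m' z =
     (\<Sum>j = 0..mix_M \<mu> m. \<Sum>h = 0..mix_M \<mu>' m'.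
        mix_C \<kappa> \<mu> m j * mix_C \<kappa>' \<mu>' m' h *
        gamma_gamma_density (mix_shape \<mu> m j) (mix_Omega g \<kappa> \<mu> m j)
          (mix_shape \<mu>' m' h) (mix_Omega g' \<kappa>' \<mu>' m' h) z)"

end

theory Submission
  imports Defs
begin

text \<open>
  With rate $a = \mu (1 + \kappa) / \bar\gamma$, the $\kappa$-$\mu$ shadowed density at $x$ is
  $a e^{-ax}$ times the power series in $t = ax$ obtained from $p^m X^\mu (1 - qX)^{-m}$ by the
  substitution $X^{n+1} \mapsto t^n / n!$. Gamma densities of rate $a$ correspond to powers of $X$ and
  those of rate $pa$ to powers of $W = pX / (1 - qX)$, so the mixture representation is the partial
  fraction expansion of $X^{\mu-m} W^m$ if $m < \mu$, and the binomial expansion of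
  $W^\mu (p + qW)^{m-\mu}$ otherwise. The product has the Mellin convolution of the two densities as
  its density; on Gamma densities it is the Bessel integral after $x = s e^t$. In the degenerate cases,
  an Erlang density dominates the densities locally uniformly in $\kappa$, so the convolution is
  continuous in $(\kappa, \hat\kappa)$.
\<close>

subsection \<open>Mellin convolution of Gamma densities\<close>

text \<open>The map from powers of X to monomials is a Laplace transform in disguise: put X = a / (a
  + s), the transform of the exponential law of rate a. Since p + q = 1, W becomes p a / (p a + s),
  so the j-th powers of X and W stand for the Gamma laws of shape j and scales
  \<open>mix_Delta1\<close> and \<open>mix_Delta2\<close>. Formal series make the expansion a ring
  identity, which returns to densities because a convergent series has only one sum.

  The weights can be negative. Mixtures therefore cannot be added up in \<open>ennreal\<close>: the
  linear steps use Bochner integrals and require integrability of every term, while the law of the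
  product is found with nonnegative integrals. \<open>mult_convolvable\<close> links the two, since
  the Bochner integral of a non-integrable function is 0 by default.

  For \<kappa> = 0 and m < \<mu> the obstacle is algebraic: q = 0 and p = 1 give W = X, the two
  poles merge and the weights lose their meaning, although the density itself stays regular.\<close>

definition mult_conv :: "(real \<Rightarrow> real) \<Rightarrow> (real \<Rightarrow> real) \<Rightarrow> real \<Rightarrow> real" where
  "mult_conv f f' z = (LBINT x:{0<..}. f x * f' (z / x) / x)"

definition mult_convolvable :: "(real \<Rightarrow> real) \<Rightarrow> (real \<Rightarrow> real) \<Rightarrow> real \<Rightarrow> bool" where
  "mult_convolvable f f' z \<longleftrightarrow> set_integrable lborel {0<..} (\<lambda>x. f x * f' (z / x) / x)"

lemma cosh_ge_quadratic: "t\<^sup>2 / 4 \<le> cosh (t::real)"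
proof -
  have "1 + \<bar>t\<bar> + \<bar>t\<bar>\<^sup>2 / 2 \<le> exp \<bar>t\<bar>"
    by (rule exp_lower_Taylor_quadratic) simp
  hence "t\<^sup>2 / 4 \<le> exp \<bar>t\<bar> / 2" by simp
  also have "\<dots> \<le> cosh t"
    by (simp add: cosh_field_def abs_if)
  finally show ?thesis .
qed

lemma integrable_exp_minus_cosh:
  fixes \<nu> y :: real
  assumes "y > 0"
  shows "integrable lborel (\<lambda>t. exp (\<nu> * t) * exp (- y * cosh t))"
proof -
  \<comment> \<open>Completing the square in \<open>\<nu> * t - y * t\<^sup>2 / 4\<close> gives a
    Gaussian with mean \<open>2 * \<nu> / y\<close> and variance \<open>2 / y\<close>.\<close>
  define \<sigma> where "\<sigma> = sqrt (2 / y)"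
  define c where "c = exp (\<nu>\<^sup>2 / y) * sqrt (2 * pi * \<sigma>\<^sup>2)"
  have \<sigma>: "\<sigma>\<^sup>2 = 2 / y" using assms by (simp add: \<sigma>_def)
  have eq: "c * normal_density (2 * \<nu> / y) \<sigma> t = exp (\<nu> * t - y * (t\<^sup>2 / 4))" for t
  proof -
    have "c * normal_density (2 * \<nu> / y) \<sigma> t = exp (\<nu>\<^sup>2 / y) * exp (- (t - 2 * \<nu> / y)\<^sup>2 / (2 * \<sigma>\<^sup>2))"
      using assms \<sigma> by (simp add: c_def normal_density_def)
    also have "\<dots> = exp (\<nu>\<^sup>2 / y + - (t - 2 * \<nu> / y)\<^sup>2 / (2 * \<sigma>\<^sup>2))" by (simp only: exp_add)
    also have "\<nu>\<^sup>2 / y + - (t - 2 * \<nu> / y)\<^sup>2 / (2 * \<sigma>\<^sup>2) = \<nu> * t - y * (t\<^sup>2 / 4)"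
      using assms unfolding \<sigma> by (simp add: field_simps power2_eq_square)
    finally show ?thesis .
  qed
  have int: "integrable lborel (\<lambda>t. c * normal_density (2 * \<nu> / y) \<sigma> t)"
    by (intro integrable_mult_right integrable_normal_density) (use assms in \<open>simp add: \<sigma>_def\<close>)
  show ?thesis
  proof (rule Bochner_Integration.integrable_bound[OF int])
    show "(\<lambda>t. exp (\<nu> * t) * exp (- y * cosh t)) \<in> borel_measurable lborel"
      by (simp add: cosh_field_def) measurable
    show "AE t in lborel. norm (exp (\<nu> * t) * exp (- y * cosh t))
            \<le> norm (c * normal_density (2 * \<nu> / y) \<sigma> t)"
    proof (rule AE_I2)
      fix t
      have "y * (t\<^sup>2 / 4) \<le> y * cosh t"
        using assms by (intro mult_left_mono cosh_ge_quadratic) auto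
      thus "norm (exp (\<nu> * t) * exp (- y * cosh t)) \<le> norm (c * normal_density (2 * \<nu> / y) \<sigma> t)"
        unfolding eq by (simp add: exp_add[symmetric])
    qed
  qed
qed

text \<open>The even part of exp(\<nu> t) is cosh(\<nu> t) and the other factor is even, so the
  whole line contributes twice the half-line integral that defines \<open>bessel_K\<close>.\<close>

lemma integral_exp_minus_cosh:
  fixes \<nu> y :: real
  assumes "y > 0"
  shows "(LBINT t. exp (\<nu> * t) * exp (- y * cosh t)) = 2 * bessel_K \<nu> y"
proof -
  define h where "h = (\<lambda>t. exp (\<nu> * t) * exp (- y * cosh t))"
  define k where "k = (\<lambda>t. exp (- y * cosh t) * cosh (\<nu> * t))"
  define k0 where "k0 = (\<lambda>t. indicator {0..} t * k t)"
  have h: "integrable lborel h"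
    unfolding h_def by (rule integrable_exp_minus_cosh[OF assms])
  hence h': "integrable lborel (\<lambda>t. h (- t))"
    using lborel_integrable_real_affine[OF h, of "-1" 0] by simp
  have k_eq: "k t = (h t + h (- t)) / 2" for t
    by (simp add: k_def h_def cosh_field_def[of "\<nu> * t"] algebra_simps)
  have k: "integrable lborel k"
    unfolding k_eq[abs_def] using h h' by (intro integrable_divide Bochner_Integration.integrable_add)
  have k0: "integrable lborel k0"
    unfolding k0_def by (rule integrable_real_mult_indicator[of "{0..}" lborel k, simplified mult.commute[of "k _"]]) (use k in auto)
  have k0': "integrable lborel (\<lambda>t. k0 (- t))"
    using lborel_integrable_real_affine[OF k0, of "-1" 0] by simp
  have refl: "(LBINT t. f (- t)) = (LBINT t. f t)" for f :: "real \<Rightarrow> real"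
    using lborel_integral_real_affine[of "-1" f 0] by simp
  have "(LBINT t. k t) = ((LBINT t. h t) + (LBINT t. h (- t))) / 2"
    unfolding k_eq using h h' by simp
  also have "\<dots> = (LBINT t. h t)" by (simp add: refl)
  finally have "(LBINT t. h t) = (LBINT t. k t)" ..
  \<comment> \<open>Folding the line at 0 counts the value at 0 twice, hence equality only almost
    everywhere.\<close>
  also have "\<dots> = (LBINT t. k0 t + k0 (- t))"
  proof (rule integral_cong_AE)
    show "AE t in lborel. k t = k0 t + k0 (- t)"
      using AE_lborel_singleton[of 0]
      by eventually_elim (auto simp: k0_def k_def indicator_def)
  qed (use k k0 k0' in auto)
  also have "\<dots> = 2 * (LBINT t. k0 t)"
    using k0 k0' by (simp add: refl)
  also have "(LBINT t. k0 t) = bessel_K \<nu> y"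
    unfolding bessel_K_def set_lebesgue_integral_def k0_def k_def by simp
  finally show ?thesis by (simp add: h_def)
qed

text \<open>The exponent x / v + z / (x w) becomes y cosh t under x = s e^t; the Jacobian cancels
  the factor 1 / x, and the remaining powers of x leave exp((a - b) t).\<close>

lemma mult_conv_erlang:
  assumes a: "a > 0" and b: "b > 0" and v: "v > 0" and w: "w > 0" and z: "z > 0"
  defines "f \<equiv> erlang_density (a - 1) (1 / v)" and "f' \<equiv> erlang_density (b - 1) (1 / w)"
  shows "mult_convolvable f f' z"
    and "mult_conv f f' z = gamma_gamma_density a v b w z"
proof -
  \<comment> \<open>The point at which both exponents agree:
    \<open>s / v = z / (s * w) = y / 2\<close>.\<close>
  define s where "s = sqrt (v * z / w)"
  define y where "y = sqrt (4 * z / (v * w))"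
  define \<nu> where "\<nu> = real a - real b"
  define c where "c = z powr ((real a + real b) / 2 - 1)
      / (Gamma (real a) * Gamma (real b) * (v * w) powr ((real a + real b) / 2))"
  define F where "F = (\<lambda>x. f x * f' (z / x) / x)"
  have s: "s > 0" and y: "y > 0" using v w z by (auto simp: s_def y_def)
  have s2: "s * s = v * z / w" using v w z by (simp add: s_def)
  have sv: "s / v = y / 2"
  proof (rule power2_eq_imp_eq)
    show "(s / v)\<^sup>2 = (y / 2)\<^sup>2" using v w z
      by (simp add: s_def y_def power_divide) (simp add: field_simps power2_eq_square)
  qed (use s v y in auto)
  have zsw: "z / (s * w) = y / 2"
    unfolding sv[symmetric] using s v w s2 by (simp add: field_simps)
  have pw: "s ^ (a - 1) / v ^ a * ((z / s) ^ (b - 1) / w ^ b)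
      = z powr ((real a + real b) / 2 - 1) / (v * w) powr ((real a + real b) / 2)"
  proof -
    \<comment> \<open>Logarithms turn the identity between integer and half-integer powers into a
      linear one in \<open>V\<close>, \<open>W\<close> and \<open>Z\<close>.\<close>
    define V W Z S where "V = ln v" and "W = ln w" and "Z = ln z" and "S = ln s"
    have S: "S = (V + Z - W) / 2"
      using v w z by (simp add: S_def V_def W_def Z_def s_def ln_sqrt ln_div ln_mult)
    have "s ^ (a - 1) = exp ((real a - 1) * S)" "v ^ a = exp (real a * V)" "w ^ b = exp (real b * W)"
         "(z / s) ^ (b - 1) = exp ((real b - 1) * (Z - S))"
      using a b s v w z by (simp_all add: S_def V_def W_def Z_def powr_realpow[symmetric] powr_def of_nat_diff Suc_leI ln_div)
    hence "s ^ (a - 1) / v ^ a * ((z / s) ^ (b - 1) / w ^ b) =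
       exp ((real a - 1) * S - real a * V + ((real b - 1) * (Z - S) - real b * W))"
      by (simp add: exp_diff exp_add)
    also have "(real a - 1) * S - real a * V + ((real b - 1) * (Z - S) - real b * W) =
       ((real a + real b) / 2 - 1) * Z - ((real a + real b) / 2) * (V + W)"
      unfolding S by (simp add: field_simps)
    also have "exp \<dots> = z powr ((real a + real b) / 2 - 1) / (v * w) powr ((real a + real b) / 2)"
      using v w z by (simp add: exp_diff powr_def V_def W_def Z_def ln_mult)
    finally show ?thesis .
  qed
  have G: "Gamma (real n) = fact (n - 1)" if "n > 0" for n
    using that Gamma_fact[of "n - 1", where ?'a = real] by (simp add: of_nat_diff Suc_leI add.commute)
  have F_eq: "F (s * exp t) * (s * exp t) = c * (exp (\<nu> * t) * exp (- y * cosh t))" for t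
  proof -
    have st: "\<not> s * exp t < 0" "\<not> z / s * exp (- t) < 0"
      using s z by (simp_all add: not_less)
    have y2: "y / 2 * exp t = s * exp t / v" by (simp add: sv[symmetric])
    have y2': "y / 2 * exp (- t) = z / s * exp (- t) / w" by (simp add: zsw[symmetric])
    have 1: "f (s * exp t) = s ^ (a - 1) / v ^ a / Gamma (real a) * (exp t ^ (a - 1) * exp (- (y / 2 * exp t)))"
      unfolding y2 using a st(1) by (simp add: f_def erlang_density_def G power_mult_distrib power_divide)
    have 2: "z / (s * exp t) = z / s * exp (- t)" by (simp add: exp_minus field_simps)
    have 3: "f' (z / (s * exp t)) = (z / s) ^ (b - 1) / w ^ b / Gamma (real b) * (exp (- t) ^ (b - 1) * exp (- (y / 2 * exp (- t))))"
      unfolding 2 y2' using b st(2) by (simp add: f'_def erlang_density_def G power_mult_distrib power_divide mult.commute)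
    have 4: "exp t ^ (a - 1) * exp (- t) ^ (b - 1) = exp (\<nu> * t)"
    proof -
      have "exp t ^ (a - 1) * exp (- t) ^ (b - 1) = exp (real (a - 1) * t + real (b - 1) * (- t))"
        by (simp only: exp_add exp_of_nat_mult)
      thus ?thesis using a b by (simp add: \<nu>_def of_nat_diff Suc_leI algebra_simps)
    qed
    have 5: "exp (- (y / 2 * exp t)) * exp (- (y / 2 * exp (- t))) = exp (- y * cosh t)"
      by (simp add: exp_add[symmetric] cosh_field_def algebra_simps add_divide_distrib)
    have "F (s * exp t) * (s * exp t) = f (s * exp t) * f' (z / (s * exp t))"
      using s by (simp add: F_def)
    also have "\<dots> = (s ^ (a - 1) / v ^ a * ((z / s) ^ (b - 1) / w ^ b)) / (Gamma (real a) * Gamma (real b)) *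
      ((exp t ^ (a - 1) * exp (- t) ^ (b - 1)) * (exp (- (y / 2 * exp t)) * exp (- (y / 2 * exp (- t)))))"
      unfolding 1 3 by (simp only: times_divide_eq_left times_divide_eq_right divide_divide_eq_left mult_ac)
    also have "\<dots> = c * (exp (\<nu> * t) * exp (- y * cosh t))"
      unfolding pw 4 5 c_def by simp
    finally show ?thesis .
  qed
  have int: "integrable lborel (\<lambda>t. F (s * exp t) * (s * exp t))"
    unfolding F_eq by (intro integrable_mult_right integrable_exp_minus_cosh y)
  have cont: "isCont F x" if "x > 0" for x
  proof -
    have "continuous_on {0<..} (\<lambda>x. (1/v) ^ a * x ^ (a - 1) * exp (- (1/v) * x) / fact (a - 1) *
        ((1/w) ^ b * (z / x) ^ (b - 1) * exp (- (1/w) * (z / x)) / fact (b - 1)) / x)"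
      by (intro continuous_intros) auto
    also have "?this \<longleftrightarrow> continuous_on {0<..} F"
      by (intro continuous_on_cong refl)
         (use a b z in \<open>auto simp: F_def f_def f'_def erlang_density_def divide_less_0_iff\<close>)
    finally show ?thesis using that by (simp add: continuous_on_eq_continuous_at)
  qed
  have nonneg: "0 \<le> F x" if "x > 0" for x
    using that v w by (simp add: F_def f_def f'_def)
  \<comment> \<open>The substitution rule for nonnegative integrands also carries integrability back
    to the variable x, so it settles both claims.\<close>
  have subst: "set_integrable lborel (einterval 0 \<infinity>) F"
       "(LBINT x=0..\<infinity>. F x) = (LBINT t=-\<infinity>..\<infinity>. F (s * exp t) * (s * exp t))"
  proof -
    have l: "((ereal \<circ> (\<lambda>t. s * exp t) \<circ> real_of_ereal) \<longlongrightarrow> 0) (at_right (-\<infinity>))"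
      unfolding comp_def at_right_MInf filterlim_filtermap zero_ereal_def
      by (subst lim_ereal, simp, intro tendsto_mult_right_zero exp_at_bot)
    have r: "((ereal \<circ> (\<lambda>t. s * exp t) \<circ> real_of_ereal) \<longlongrightarrow> \<infinity>) (at_left \<infinity>)"
    proof -
      have "filterlim (\<lambda>t. s * exp t) at_top at_top"
        using s by (intro filterlim_tendsto_pos_mult_at_top[OF tendsto_const] exp_at_top)
      thus ?thesis
        by (auto simp: at_left_PInf filterlim_filtermap tendsto_PInfty_eq_at_top comp_def)
    qed
    have si: "set_integrable lborel (einterval (-\<infinity>) \<infinity>) (\<lambda>t. F (s * exp t) * (s * exp t))"
      using int by (simp add: set_integrable_def)
    have "set_integrable lborel (einterval 0 \<infinity>) F \<and>
       (LBINT x=0..\<infinity>. F x) = (LBINT t=-\<infinity>..\<infinity>. F (s * exp t) * (s * exp t))"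
      using s nonneg cont
      by (intro conjI interval_integral_substitution_nonneg[OF _ _ _ _ _ _ l r si])
         (auto intro!: derivative_eq_intros continuous_intros)
    thus "set_integrable lborel (einterval 0 \<infinity>) F"
       "(LBINT x=0..\<infinity>. F x) = (LBINT t=-\<infinity>..\<infinity>. F (s * exp t) * (s * exp t))" by auto
  qed
  have e: "einterval 0 \<infinity> = {0::real<..}" by (auto simp: einterval_def)
  show "mult_convolvable f f' z"
    using subst(1) unfolding mult_convolvable_def e F_def .
  have "mult_conv f f' z = (LBINT x=0..\<infinity>. F x)"
    by (simp add: mult_conv_def interval_lebesgue_integral_def e F_def)
  also have "\<dots> = (LBINT t. F (s * exp t) * (s * exp t))"
    unfolding subst(2) by (simp add: interval_lebesgue_integral_def set_lebesgue_integral_def)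
  also have "\<dots> = c * (2 * bessel_K \<nu> y)"
    unfolding F_eq integral_mult_right_zero integral_exp_minus_cosh[OF y] ..
  also have "\<dots> = gamma_gamma_density a v b w z"
    by (simp add: gamma_gamma_density_def c_def \<nu>_def y_def)
  finally show "mult_conv f f' z = gamma_gamma_density a v b w z" .
qed

subsection \<open>Partial fractions and the mixture representation\<close>

text \<open>With w = s / (1 - r / z), this is z^n w^m / s^m expanded in r / z and cut off after the
  positive powers of z: the principal part at z = infinity.\<close>

definition pf_sum :: "nat \<Rightarrow> nat \<Rightarrow> 'a::comm_ring_1 \<Rightarrow> 'a \<Rightarrow> 'a" where
  "pf_sum n m r z = (\<Sum>l<n. of_nat ((m + l - 1) choose l) * r ^ l * z ^ (n - l))"

lemma pf_sum_0_right: "pf_sum n 0 r z = (if n = 0 then 0 else z ^ n)"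
proof -
  \<comment> \<open>Truncated subtraction matters at m = 0: the coefficient is 0 choose 0 = 1 for l
    = 0, and l - 1 choose l = 0 afterwards.\<close>
  have "pf_sum n 0 r z = (\<Sum>l<n. if l = 0 then z ^ n else 0)"
    unfolding pf_sum_def by (intro sum.cong) (auto simp: binomial_eq_0)
  thus ?thesis by simp
qed

text \<open>Pascal's rule for the coefficients, in the form that the induction for the expansion
  consumes.\<close>

lemma pf_sum_Suc: "pf_sum (Suc n) (Suc m) r z = r * pf_sum n (Suc m) r z + pf_sum (Suc n) m r z"
proof -
  have pascal: "(m + Suc l) choose Suc l = (m + l choose l) + ((m + Suc l - 1) choose Suc l)" for l
    by simp
  have "pf_sum (Suc n) (Suc m) r z = z ^ Suc n + (\<Sum>l<n. of_nat ((m + Suc l) choose (Suc l)) * r ^ Suc l * z ^ (n - l))"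
    unfolding pf_sum_def by (subst sum.lessThan_Suc_shift) simp
  also have "\<dots> = (\<Sum>l<n. of_nat (m + l choose l) * r ^ Suc l * z ^ (n - l)) +
     (z ^ Suc n + (\<Sum>l<n. of_nat ((m + Suc l - 1) choose (Suc l)) * r ^ Suc l * z ^ (n - l)))"
    unfolding pascal of_nat_add distrib_right sum.distrib by (simp only: ac_simps)
  also have "z ^ Suc n + (\<Sum>l<n. of_nat ((m + Suc l - 1) choose (Suc l)) * r ^ Suc l * z ^ (n - l)) = pf_sum (Suc n) m r z"
    unfolding pf_sum_def by (subst sum.lessThan_Suc_shift) simp
  also have "(\<Sum>l<n. of_nat (m + l choose l) * r ^ Suc l * z ^ (n - l)) = r * pf_sum n (Suc m) r z"
    unfolding pf_sum_def sum_distrib_left by (intro sum.cong) (auto simp: algebra_simps)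
  finally show ?thesis .
qed

text \<open>The relation reads (z - r)(w - s) = r s. For numbers, the two sums are the principal
  parts of z^n w^m at z = infinity and w = infinity, and no constant is left over because all terms
  vanish at z = w = 0; this fails for n = m = 0. The proof divides nowhere, as \<open>fps_X\<close>
  and \<open>fps_W\<close> are not units: each use of the relation lowers one exponent, and
  \<open>pf_sum_Suc\<close> reassembles the sums.\<close>

lemma partial_fraction_expansion:
  fixes z w r s :: "'a :: comm_ring_1"
  assumes zw: "z * w = r * w + s * z"
  shows "n + m > 0 \<Longrightarrow> z ^ n * w ^ m = s ^ m * pf_sum n m r z + r ^ n * pf_sum m n s w"
proof (induction "n + m" arbitrary: n m)
  case (Suc k)
  show ?case
  proof (cases "n = 0 \<or> m = 0")
    case True
    thus ?thesis using Suc.prems by (auto simp: pf_sum_0_right) (auto simp: pf_sum_def)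
  next
    case False
    then obtain n' m' where nm: "n = Suc n'" "m = Suc m'" by (metis not0_implies_Suc)
    have "z ^ n * w ^ m = (z * w) * (z ^ n' * w ^ m')" by (simp add: nm algebra_simps)
    also have "\<dots> = r * (z ^ n' * w ^ m) + s * (z ^ n * w ^ m')"
      unfolding zw by (simp add: nm algebra_simps)
    also have "z ^ n' * w ^ m = s ^ m * pf_sum n' m r z + r ^ n' * pf_sum m n' s w"
      by (rule Suc.hyps) (use Suc.hyps nm in auto)
    also have "z ^ n * w ^ m' = s ^ m' * pf_sum n m' r z + r ^ n * pf_sum m' n s w"
      by (rule Suc.hyps) (use Suc.hyps nm in auto)
    also have "r * (s ^ m * pf_sum n' m r z + r ^ n' * pf_sum m n' s w) +
        s * (s ^ m' * pf_sum n m' r z + r ^ n * pf_sum m' n s w) =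
        s ^ m * (r * pf_sum n' (Suc m') r z + pf_sum (Suc n') m' r z) +
        r ^ n * (s * pf_sum m' (Suc n') s w + pf_sum (Suc m') n' s w)"
      by (simp add: nm algebra_simps)
    also have "\<dots> = s ^ m * pf_sum n m r z + r ^ n * pf_sum m n s w"
      by (simp only: pf_sum_Suc nm)
    finally show ?thesis .
  qed
qed simp

text \<open>Sends \<open>X ^ Suc n\<close> to \<open>t ^ n / n!\<close>: the inverse Laplace transform in the variable \<open>1 / s\<close>.\<close>
definition borel_sums :: "real fps \<Rightarrow> real \<Rightarrow> real \<Rightarrow> bool" where
  "borel_sums F t S \<longleftrightarrow> (\<lambda>n. fps_nth F (Suc n) * t ^ n / fact n) sums S"

lemma borel_sums_unique: "borel_sums F t S \<Longrightarrow> borel_sums F t S' \<Longrightarrow> S = S'"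
  by (auto simp: borel_sums_def intro: sums_unique2)

lemma borel_sums_const_mult: "borel_sums F t S \<Longrightarrow> borel_sums (fps_const c * F) t (c * S)"
  unfolding borel_sums_def by (auto dest: sums_mult[of _ _ c] simp: mult.assoc)

lemma borel_sums_sum:
  "(\<And>i. i \<in> I \<Longrightarrow> borel_sums (F i) t (S i)) \<Longrightarrow> borel_sums (\<Sum>i\<in>I. F i) t (\<Sum>i\<in>I. S i)"
  unfolding borel_sums_def fps_sum_nth sum_distrib_right sum_divide_distrib by (rule sums_sum)

lemma borel_sums_X_power: "j > 0 \<Longrightarrow> borel_sums (fps_X ^ j) t (t ^ (j - 1) / fact (j - 1))"
proof -
  assume j: "j > 0"
  have "(\<lambda>n. if n = j - 1 then t ^ n / fact n else 0) sums (t ^ (j - 1) / fact (j - 1))"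
    by (rule sums_single)
  also have "(\<lambda>n. if n = j - 1 then t ^ n / fact n else 0) =
      (\<lambda>n. fps_nth (fps_X ^ j) (Suc n) * t ^ n / fact n)"
    using j by (auto simp: fun_eq_iff)
  finally show ?thesis unfolding borel_sums_def .
qed

section \<open>Power series of the Gamma laws of the smaller rate\<close>

definition fps_W :: "real \<Rightarrow> real \<Rightarrow> real fps" where
  "fps_W p q = fps_const p * fps_X * inverse (1 - fps_const q * fps_X)"

lemma inverse_one_minus_const_X:
  "(1 - fps_const q * fps_X) * inverse (1 - fps_const q * fps_X :: real fps) = 1"
  by (simp add: inverse_mult_eq_1')

lemma nth_X_power_mult_inverse_power:
  fixes q :: real
  assumes "j > 0"
  shows "fps_nth (fps_X ^ i * inverse ((1 - fps_const q * fps_X) ^ j)) n =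
    (if n < i then 0 else of_nat ((j + (n - i) - 1) choose (n - i)) * q ^ (n - i))"
  using assms by (simp add: one_minus_const_fps_X_neg_power' fps_X_power_mult_nth)

lemma fps_W_power: "fps_W p q ^ j = fps_const (p ^ j) * (fps_X ^ j * inverse ((1 - fps_const q * fps_X) ^ j))"
  by (simp add: fps_W_def power_mult_distrib fps_const_power fps_inverse_power mult.assoc)

lemma sums_shift_if:
  fixes f :: "nat \<Rightarrow> real"
  assumes "f sums S"
  shows "(\<lambda>n. if n < k then 0 else f (n - k)) sums S"
proof -
  have "(\<lambda>n. if n + k < k then 0 else f (n + k - k)) sums S" using assms by simp
  thus ?thesis
    using sums_iff_shift[of "\<lambda>n. if n < k then 0 else f (n - k)" k S] by simp
qed

text \<open>With i = j - 1, the coefficient at X^(i + k + 1) contains (i + k) choose k; dividing by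
  (i + k)! leaves 1 / (i! k!), so the series splits into a monomial times an exponential
  series.\<close>

lemma borel_sums_W_power:
  assumes j: "j > 0"
  shows "borel_sums (fps_W p q ^ j) t (p ^ j * t ^ (j - 1) / fact (j - 1) * exp (q * t))"
proof -
  have "(\<lambda>n. p ^ j * t ^ (j - 1) / fact (j - 1) * ((q * t) ^ n / fact n)) sums
          (p ^ j * t ^ (j - 1) / fact (j - 1) * exp (q * t))"
    using exp_converges[of "q * t"] by (intro sums_mult) (simp add: scaleR_conv_of_real field_simps)
  hence "(\<lambda>n. if n < j - 1 then 0 else p ^ j * t ^ (j - 1) / fact (j - 1) * ((q * t) ^ (n - (j - 1)) / fact (n - (j - 1)))) sums
          (p ^ j * t ^ (j - 1) / fact (j - 1) * exp (q * t))"
    by (rule sums_shift_if)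
  also have "(\<lambda>n. if n < j - 1 then 0 else p ^ j * t ^ (j - 1) / fact (j - 1) * ((q * t) ^ (n - (j - 1)) / fact (n - (j - 1)))) =
      (\<lambda>n. fps_nth (fps_W p q ^ j) (Suc n) * t ^ n / fact n)" (is "?l = ?r")
  proof
    fix n
    obtain i where i: "j = Suc i" using j by (metis gr0_implies_Suc)
    show "?l n = ?r n"
    proof (cases "n < i")
      case True
      thus ?thesis by (simp add: i fps_W_power nth_X_power_mult_inverse_power del: power_Suc)
    next
      case False
      then obtain k where k: "n = i + k" by (metis le_add_diff_inverse not_less)
      have "real ((i + k) choose k) = fact (i + k) / (fact k * fact i)"
        by (subst binomial_fact) auto
      thus ?thesis unfolding k i
        by (simp add: fps_W_power nth_X_power_mult_inverse_power power_add power_mult_distrib del: power_Suc) (simp only: mult_ac)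
    qed
  qed
  finally show ?thesis unfolding borel_sums_def .
qed

lemma sum_lessThan_add: "(\<Sum>i<n + m. f i) = (\<Sum>i<n. f i) + (\<Sum>i<m. f (n + i :: nat))"
  for f :: "nat \<Rightarrow> 'a::comm_monoid_add"
  by (induction m) (simp_all add: add.assoc)

lemma fps_W_relation: "fps_W p q - fps_const q * (fps_X * fps_W p q) = fps_const p * fps_X"
proof -
  have "fps_W p q - fps_const q * (fps_X * fps_W p q) =
      fps_const p * fps_X * ((1 - fps_const q * fps_X) * inverse (1 - fps_const q * fps_X))"
    by (simp add: fps_W_def algebra_simps)
  thus ?thesis by (simp only: inverse_one_minus_const_X mult_1_right)
qed

section \<open>The mixture expansion as an identity of power series\<close>

definition mix_fps :: "real \<Rightarrow> nat \<Rightarrow> nat \<Rightarrow> real fps" where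
  "mix_fps \<kappa> \<mu> m = fps_const (mix_p \<kappa> \<mu> m ^ m) *
     (fps_X ^ \<mu> * inverse ((1 - fps_const (mix_q \<kappa> \<mu> m) * fps_X) ^ m))"

text \<open>The series whose powers encode Gamma laws of scale \<open>mix_Omega\<close>, with the
  same case split.\<close>

definition mix_base :: "real \<Rightarrow> nat \<Rightarrow> nat \<Rightarrow> nat \<Rightarrow> real fps" where
  "mix_base \<kappa> \<mu> m i =
     (if m < \<mu> \<and> i \<le> \<mu> - m then fps_X else fps_W (mix_p \<kappa> \<mu> m) (mix_q \<kappa> \<mu> m))"

lemma mix_fps_expansion:
  assumes \<kappa>: "\<kappa> \<ge> 0" and m: "m > 0" and deg: "\<kappa> = 0 \<longrightarrow> \<mu> \<le> m"
  shows "(\<Sum>i = 0..mix_M \<mu> m. fps_const (mix_C \<kappa> \<mu> m i) * mix_base \<kappa> \<mu> m i ^ mix_shape \<mu> m i) =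
    mix_fps \<kappa> \<mu> m"
proof -
  define p q where "p = mix_p \<kappa> \<mu> m" and "q = mix_q \<kappa> \<mu> m"
  define W where "W = fps_W p q"
  show ?thesis
  proof (cases "m < \<mu>")
    case True
    define n where "n = \<mu> - m"
    have \<mu>: "\<mu> = n + m" and n: "n > 0" using True by (auto simp: n_def)
    have "\<kappa> > 0" using deg \<kappa> True by (cases "\<kappa> = 0") auto
    hence "real \<mu> * \<kappa> + real m > 0" "real \<mu> * \<kappa> > 0" using m \<mu> by (simp_all add: add_nonneg_pos)
    hence q: "q \<noteq> 0" unfolding q_def mix_q_def by (metis divide_eq_0_iff less_irrefl)
    \<comment> \<open>Dividing \<open>fps_W_relation\<close> by q brings it to the form z w = r w +
      s z. This requires q \<noteq> 0, which \<open>deg\<close> secures when m < \<mu>.\<close>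
    define r s where "r = 1 / q" and "s = - p / q"
    have rel: "fps_X * W = fps_const r * W + fps_const s * fps_X"
    proof -
      have "fps_const q * (fps_X * W) = W - fps_const p * fps_X"
        using fps_W_relation[of p q] by (simp add: W_def algebra_simps)
      hence "fps_const r * (fps_const q * (fps_X * W)) = fps_const r * (W - fps_const p * fps_X)"
        by simp
      moreover have "fps_const r * (fps_const q * (fps_X * W)) = fps_X * W"
        using q by (simp add: r_def mult.assoc[symmetric])
      ultimately have "fps_X * W = fps_const r * W - fps_const (r * p) * fps_X"
        by (simp only: right_diff_distrib fps_const_mult[symmetric] mult.assoc)
      also have "r * p = - s" by (simp add: r_def s_def)
      finally show ?thesis by (simp flip: fps_const_neg)
    qed
    define T where "T i = fps_const (mix_C \<kappa> \<mu> m i) * mix_base \<kappa> \<mu> m i ^ mix_shape \<mu> m i" for i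
    have s_pow: "s ^ k = (-1) ^ k * p ^ k / q ^ k" and r_pow: "r ^ k = 1 / q ^ k"
      and q_pow: "q powi (- int k) = 1 / q ^ k" for k
      by (simp_all add: s_def r_def power_divide power_minus[of "p / q" k] power_int_minus power_inverse[symmetric] inverse_eq_divide)
    have const: "fps_const c ^ k * (of_nat b * fps_const d ^ l * Y) = fps_const (c ^ k * (real b * d ^ l)) * Y"
      for c d :: real and b k l and Y
      by (simp add: fps_of_nat[symmetric] fps_const_power mult.assoc[symmetric])
    have T0: "T 0 = 0" using True by (simp add: T_def mix_C_def Let_def)
    have T1: "T (Suc l) = fps_const s ^ m * (of_nat ((m + l - 1) choose l) * fps_const r ^ l * fps_X ^ (n - l))"
      if "l < n" for l
    proof -
      have "mix_C \<kappa> \<mu> m (Suc l) = (-1) ^ m * real ((m + l - 1) choose l) * p ^ m * q powi (- int (m + l))"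
        using that True \<mu> by (simp add: mix_C_def Let_def p_def q_def)
      also have "\<dots> = s ^ m * (real ((m + l - 1) choose l) * r ^ l)"
        unfolding q_pow s_pow r_pow power_add by (simp add: mult_ac)
      finally have C: "mix_C \<kappa> \<mu> m (Suc l) = s ^ m * (real ((m + l - 1) choose l) * r ^ l)" .
      have "mix_base \<kappa> \<mu> m (Suc l) = fps_X" "mix_shape \<mu> m (Suc l) = n - l"
        using that True \<mu> by (simp_all add: mix_base_def mix_shape_def Suc_diff_Suc)
      thus ?thesis unfolding const T_def C by simp
    qed
    have T2: "T (Suc (n + l)) = fps_const r ^ n * (of_nat ((n + l - 1) choose l) * fps_const s ^ l * W ^ (m - l))"
      if "l < m" for l
    proof -
      have "mix_C \<kappa> \<mu> m (Suc (n + l)) = (-1) ^ l * real ((n + l - 1) choose l) * p ^ l * q powi (- int (n + l))"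
        using that True \<mu> by (simp add: mix_C_def Let_def p_def q_def)
      also have "\<dots> = r ^ n * (real ((n + l - 1) choose l) * s ^ l)"
        unfolding q_pow s_pow r_pow power_add by (simp add: mult_ac)
      finally have C: "mix_C \<kappa> \<mu> m (Suc (n + l)) = r ^ n * (real ((n + l - 1) choose l) * s ^ l)" .
      have "mix_base \<kappa> \<mu> m (Suc (n + l)) = W" "mix_shape \<mu> m (Suc (n + l)) = m - l"
        using that True \<mu> by (simp_all add: mix_base_def mix_shape_def W_def p_def q_def)
      thus ?thesis unfolding const T_def C by simp
    qed
    \<comment> \<open>Index 0 carries weight 0. After a shift by one, the first \<open>n\<close>
      indices give the powers of X and the last \<open>m\<close> those of W, one
      \<open>pf_sum\<close> each.\<close>
    have "(\<Sum>i = 0..mix_M \<mu> m. T i) = T 0 + (\<Sum>i<n + m. T (Suc i))"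
      using True by (simp only: mix_M_def \<mu> if_True atLeast0AtMost lessThan_Suc_atMost[symmetric] sum.lessThan_Suc_shift)
    also have "\<dots> = fps_const s ^ m * pf_sum n m (fps_const r) fps_X + fps_const r ^ n * pf_sum m n (fps_const s) W"
      unfolding T0 sum_lessThan_add pf_sum_def sum_distrib_left
      using T1 T2 by (simp add: add.commute)
    also have "\<dots> = fps_X ^ n * W ^ m"
      using partial_fraction_expansion[OF rel, of n m] n by simp
    also have "\<dots> = mix_fps \<kappa> \<mu> m"
      unfolding W_def fps_W_power mix_fps_def \<mu> by (simp add: p_def q_def \<mu> power_add mult_ac)
    finally show ?thesis unfolding T_def .
  next
    case False
    define n where "n = m - \<mu>"
    have m_eq: "m = \<mu> + n" using False by (simp add: n_def)
    define I where "I = inverse (1 - fps_const q * fps_X)"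
    \<comment> \<open>Of the m factors p / (1 - q X) in \<open>mix_fps\<close>, \<mu> are absorbed
      by the power of W; the other m - \<mu> are affine in W.\<close>
    have pqW: "fps_const p + fps_const q * W = fps_const p * I"
    proof -
      have "fps_const p + fps_const q * W = fps_const p * ((1 - fps_const q * fps_X) * I) + fps_const q * W"
        by (simp only: I_def inverse_one_minus_const_X mult_1_right)
      thus ?thesis by (simp add: W_def fps_W_def I_def algebra_simps)
    qed
    have "(\<Sum>i = 0..mix_M \<mu> m. fps_const (mix_C \<kappa> \<mu> m i) * mix_base \<kappa> \<mu> m i ^ mix_shape \<mu> m i) =
        (\<Sum>i\<le>n. W ^ \<mu> * (of_nat (n choose i) * fps_const p ^ i * (fps_const q * W) ^ (n - i)))"
    proof (intro sum.cong)
      fix i assume i: "i \<in> {..n}"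
      hence "m - i = \<mu> + (n - i)" using m_eq by simp
      hence "mix_base \<kappa> \<mu> m i = W" "mix_shape \<mu> m i = \<mu> + (n - i)"
          "mix_C \<kappa> \<mu> m i = real (n choose i) * p ^ i * q ^ (n - i)"
        using False by (simp_all add: mix_base_def mix_shape_def W_def mix_C_def Let_def p_def q_def n_def)
      thus "fps_const (mix_C \<kappa> \<mu> m i) * mix_base \<kappa> \<mu> m i ^ mix_shape \<mu> m i =
        W ^ \<mu> * (of_nat (n choose i) * fps_const p ^ i * (fps_const q * W) ^ (n - i))"
        by (simp only: power_add power_mult_distrib fps_const_mult[symmetric] fps_const_power[symmetric]
            fps_of_nat mult_ac)
    next
      show "{0..mix_M \<mu> m} = {..n}" using False by (simp add: mix_M_def n_def atLeast0AtMost)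
    qed
    also have "\<dots> = W ^ \<mu> * (fps_const p + fps_const q * W) ^ n"
      unfolding binomial_ring sum_distrib_left ..
    also have "\<dots> = mix_fps \<kappa> \<mu> m"
      unfolding pqW mix_fps_def p_def[symmetric] q_def[symmetric]
      unfolding m_eq fps_inverse_power I_def W_def fps_W_def
      by (simp only: power_mult_distrib power_add fps_const_power[symmetric] fps_const_mult[symmetric] mult_ac)
    finally show ?thesis .
  qed
qed

lemma mix_p_pos: "\<kappa> \<ge> 0 \<Longrightarrow> m > 0 \<Longrightarrow> 0 < mix_p \<kappa> \<mu> m"
  and mix_q_nonneg: "\<kappa> \<ge> 0 \<Longrightarrow> 0 \<le> mix_q \<kappa> \<mu> m"
  and mix_p_plus_q: "\<kappa> \<ge> 0 \<Longrightarrow> m > 0 \<Longrightarrow> mix_p \<kappa> \<mu> m + mix_q \<kappa> \<mu> m = 1"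
proof -
  assume \<kappa>: "\<kappa> \<ge> 0"
  thus "0 \<le> mix_q \<kappa> \<mu> m" by (simp add: mix_q_def)
  assume "m > 0"
  hence "real \<mu> * \<kappa> + real m > 0" using \<kappa> by (simp add: add_nonneg_pos)
  thus "0 < mix_p \<kappa> \<mu> m" "mix_p \<kappa> \<mu> m + mix_q \<kappa> \<mu> m = 1"
    using \<open>m > 0\<close> by (simp_all add: mix_p_def mix_q_def add_divide_distrib[symmetric])
qed

lemma erlang_density_eq:
  assumes "x > 0"
  shows "erlang_density (j - 1) l x = l * (l * x) ^ (j - 1) / fact (j - 1) * exp (- (l * x))"
  using assms by (simp add: erlang_density_def power_mult_distrib)

lemma erlang_density_scaled_eq:
  assumes "x > 0" "j > 0" "p + q = 1"
  shows "erlang_density (j - 1) (p * l) x =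
    l * exp (- (l * x)) * (p ^ j * (l * x) ^ (j - 1) / fact (j - 1) * exp (q * (l * x)))"
proof -
  obtain i where j: "j = Suc i" using assms(2) by (metis gr0_implies_Suc)
  have "exp (- (p * l * x)) = exp (- (l * x)) * exp (q * (l * x))"
  proof -
    have "- (p * l * x) = - (l * x) + q * (l * x)"
    proof -
      have "p = 1 - q" using assms(3) by simp
      thus ?thesis by (simp add: left_diff_distrib mult.assoc)
    qed
    thus ?thesis by (simp only: exp_add)
  qed
  thus ?thesis using assms(1)
    by (simp add: j erlang_density_def power_mult_distrib mult_ac)
qed

section \<open>The Kummer function with positive integer parameters\<close>

lemma pochhammer_real_nat: "pochhammer (real (Suc i)) k = fact (i + k) / fact i"
proof (induction k)
  case (Suc k)
  have "pochhammer (real (Suc i)) (Suc k) = fact (i + k) / fact i * real (Suc (i + k))"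
    unfolding pochhammer_Suc Suc.IH by (simp add: ac_simps)
  thus ?case by (simp add: mult.commute)
qed simp

text \<open>The binomial is a coefficient of (1 - X)^(-i - 1). The other factor is at most 1, and in
  the Borel sum it turns 1 / (k! j!) into the required 1 / (j + k)!.\<close>

lemma kummer_nat_coeff:
  "pochhammer (real (Suc i)) k / pochhammer (real (Suc j)) k =
     real ((i + k) choose k) * (fact k * fact j / fact (j + k))"
  unfolding pochhammer_real_nat by (subst binomial_fact) (auto simp: field_simps)

text \<open>A single term of the binomial expansion of (x + (1 - x))^(i + k) is at most 1.\<close>

lemma neg_binomial_coeff_le:
  fixes x :: real
  assumes "0 < x" "x < 1"
  shows "real ((i + k) choose k) \<le> (1 / x) ^ k / (1 - x) ^ i"
proof -
  have "real ((i + k) choose k) * x ^ k * (1 - x) ^ (i + k - k) \<le>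
      (\<Sum>l\<le>i + k. real ((i + k) choose l) * x ^ l * (1 - x) ^ (i + k - l))"
    by (rule member_le_sum) (use assms in auto)
  also have "\<dots> = (x + (1 - x)) ^ (i + k)" by (rule binomial_ring[symmetric])
  finally show ?thesis using assms by (simp add: field_simps)
qed

lemma fact_mult_le_fact_add: "(fact i * fact k :: real) \<le> fact (i + k)"
proof -
  have "fact i * fact k dvd (fact (i + k) :: nat)"
    using fact_fact_dvd_fact[of i k] .
  hence "fact i * fact k \<le> (fact (i + k) :: nat)" by (intro dvd_imp_le) auto
  hence "real (fact i * fact k) \<le> real (fact (i + k))" by (rule of_nat_mono)
  thus ?thesis by simp
qed

text \<open>The parameter x trades the constant against the growth rate: for x near 1 the majorant
  grows hardly faster than exp(y), which the uniform Erlang bound on the density depends on.\<close>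

lemma kummer_nat_term_le:
  fixes x y :: real
  assumes "0 < x" "x < 1" "m > 0" "\<mu> > 0" 
  shows "norm (pochhammer (real m) k / pochhammer (real \<mu>) k * y ^ k / fact k)
    \<le> 1 / (1 - x) ^ (m - 1) * ((\<bar>y\<bar> / x) ^ k / fact k)"
proof -
  obtain i j where ij: "m = Suc i" "\<mu> = Suc j" using assms by (metis gr0_implies_Suc)
  have "pochhammer (real m) k / pochhammer (real \<mu>) k \<le> real ((i + k) choose k) * 1"
    unfolding ij kummer_nat_coeff
    by (intro mult_left_mono) (use fact_mult_le_fact_add[of j k] in \<open>auto simp: mult.commute\<close>)
  also have "\<dots> \<le> (1 / x) ^ k / (1 - x) ^ i"
    using neg_binomial_coeff_le[OF assms(1,2)] by simp
  finally have le: "pochhammer (real m) k / pochhammer (real \<mu>) k \<le> (1 / x) ^ k / (1 - x) ^ i" .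
  have "0 \<le> pochhammer (real m) k / pochhammer (real \<mu>) k"
    by (intro divide_nonneg_nonneg pochhammer_nonneg) (use assms in auto)
  hence "norm (pochhammer (real m) k / pochhammer (real \<mu>) k * (y ^ k / fact k)) =
      pochhammer (real m) k / pochhammer (real \<mu>) k * (\<bar>y\<bar> ^ k / fact k)"
    unfolding norm_mult[of "pochhammer (real m) k / pochhammer (real \<mu>) k"]
    by (simp only: real_norm_def abs_of_nonneg) (simp add: abs_divide power_abs)
  also have "\<dots> \<le> (1 / x) ^ k / (1 - x) ^ i * (\<bar>y\<bar> ^ k / fact k)"
    using le by (rule mult_right_mono) auto
  also have "\<dots> = 1 / (1 - x) ^ (m - 1) * ((\<bar>y\<bar> / x) ^ k / fact k)"
    by (simp add: ij power_divide)
  finally show ?thesis by (simp only: times_divide_eq_right)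
qed

lemma kummer_nat_summable:
  assumes "m > 0" "\<mu> > 0" 
  shows "summable (\<lambda>k. pochhammer (real m) k / pochhammer (real \<mu>) k * y ^ k / fact k)"
proof (rule summable_comparison_test'[where N = 0])
  show "summable (\<lambda>k. 1 / (1 - 1/2) ^ (m - 1) * ((\<bar>y\<bar> / (1/2)) ^ k / fact k))"
    using summable_exp[of "\<bar>y\<bar> / (1/2)"] by (intro summable_mult) (simp add: field_simps)
  show "norm (pochhammer (real m) k / pochhammer (real \<mu>) k * y ^ k / fact k)
    \<le> 1 / (1 - 1/2) ^ (m - 1) * ((\<bar>y\<bar> / (1/2)) ^ k / fact k)" for k
    by (rule kummer_nat_term_le) (use assms in auto)
qed

lemma kummer_nat_le:
  assumes "0 < x" "x < 1" "m > 0" "\<mu> > 0" "0 \<le> y"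
  shows "kummer_1F1 (real m) (real \<mu>) y \<le> 1 / (1 - x) ^ (m - 1) * exp (y / x)"
    and "0 \<le> kummer_1F1 (real m) (real \<mu>) y"
proof -
  have s: "(\<lambda>k. 1 / (1 - x) ^ (m - 1) * ((\<bar>y\<bar> / x) ^ k / fact k)) sums (1 / (1 - x) ^ (m - 1) * exp (y / x))"
    using exp_converges[of "y / x"] assms by (intro sums_mult) (simp add: scaleR_conv_of_real field_simps)
  have "pochhammer (real m) k / pochhammer (real \<mu>) k * y ^ k / fact k \<le> 1 / (1 - x) ^ (m - 1) * ((\<bar>y\<bar> / x) ^ k / fact k)" for k
    using kummer_nat_term_le[OF assms(1-4), of k y] unfolding real_norm_def by (rule order_trans[OF abs_ge_self])
  from suminf_le[OF this kummer_nat_summable[OF assms(3,4)] sums_summable[OF s]]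
  show "kummer_1F1 (real m) (real \<mu>) y \<le> 1 / (1 - x) ^ (m - 1) * exp (y / x)"
    using sums_unique[OF s] by (simp add: kummer_1F1_def)
  show "0 \<le> kummer_1F1 (real m) (real \<mu>) y"
    unfolding kummer_1F1_def
    by (intro suminf_nonneg kummer_nat_summable divide_nonneg_nonneg mult_nonneg_nonneg pochhammer_nonneg)
       (use assms in auto)
qed

lemma isCont_kummer_nat:
  assumes "m > 0" "\<mu> > 0" 
  shows "isCont (kummer_1F1 (real m) (real \<mu>)) y"
proof -
  have eq: "kummer_1F1 (real m) (real \<mu>) = (\<lambda>y. \<Sum>k. pochhammer (real m) k / pochhammer (real \<mu>) k / fact k * y ^ k)"
    by (simp add: kummer_1F1_def[abs_def])
  show ?thesis unfolding eq
    by (rule isCont_powser_converges_everywhere)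
       (use kummer_nat_summable[OF assms] in simp)
qed

section \<open>From power series back to the shadowed density\<close>

lemma kms_density_eq:
  assumes "g > 0" "\<kappa> \<ge> 0" "\<mu> > 0" "m > 0" "x > 0"
  defines "a \<equiv> real \<mu> * (1 + \<kappa>) / g"
  shows "kms_density g \<kappa> (real \<mu>) (real m) x =
    a * exp (- (a * x)) * (mix_p \<kappa> \<mu> m ^ m * (a * x) ^ (\<mu> - 1) / fact (\<mu> - 1) *
      kummer_1F1 (real m) (real \<mu>) (mix_q \<kappa> \<mu> m * (a * x)))"
proof -
  have pos: "real \<mu> * \<kappa> + real m > 0" using assms by (simp add: add_nonneg_pos)
  obtain j where j: "\<mu> = Suc j" using assms by (metis gr0_implies_Suc)
  have G: "Gamma (real \<mu>) = fact (\<mu> - 1)"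
    using Gamma_fact[of j, where ?'a = real] by (simp add: j add.commute)
  have y: "(real \<mu>)\<^sup>2 * \<kappa> * (1 + \<kappa>) / (real \<mu> * \<kappa> + real m) * (x / g) = mix_q \<kappa> \<mu> m * (a * x)"
    by (simp add: mix_q_def a_def power2_eq_square)
  have e: "real \<mu> * (1 + \<kappa>) * x / g = a * x" by (simp add: a_def)
  have pw: "real \<mu> powr real \<mu> = real \<mu> ^ \<mu>" "real m powr real m = real m ^ m"
      "(1 + \<kappa>) powr real \<mu> = (1 + \<kappa>) ^ \<mu>" "(real \<mu> * \<kappa> + real m) powr real m = (real \<mu> * \<kappa> + real m) ^ m"
      "(x / g) powr (real \<mu> - 1) = (x / g) ^ (\<mu> - 1)"
    using assms pos by (simp_all add: powr_realpow j del: of_nat_Suc) (simp add: powr_realpow)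
  have c: "real \<mu> ^ \<mu> * real m ^ m * (1 + \<kappa>) ^ \<mu> / (fact (\<mu> - 1) * g * (real \<mu> * \<kappa> + real m) ^ m) * (x / g) ^ (\<mu> - 1)
     = a * (mix_p \<kappa> \<mu> m ^ m * (a * x) ^ (\<mu> - 1) / fact (\<mu> - 1))"
    by (simp add: j mix_p_def a_def power_mult_distrib power_divide mult_ac)
  show ?thesis
    using assms(5) unfolding kms_density_def pw G y e c by simp
qed

lemma borel_sums_kummer:
  assumes "\<mu> > 0" "m > 0"
  shows "borel_sums (mix_fps \<kappa> \<mu> m) t (mix_p \<kappa> \<mu> m ^ m * t ^ (\<mu> - 1) / fact (\<mu> - 1) *
      kummer_1F1 (real m) (real \<mu>) (mix_q \<kappa> \<mu> m * t))"
proof -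
  obtain i j where ij: "m = Suc i" "\<mu> = Suc j" using assms by (metis gr0_implies_Suc)
  define p q where "p = mix_p \<kappa> \<mu> m" and "q = mix_q \<kappa> \<mu> m"
  let ?f = "\<lambda>k. p ^ m * t ^ j / fact j * (pochhammer (real m) k / pochhammer (real \<mu>) k * (q * t) ^ k / fact k)"
  have "?f sums (p ^ m * t ^ j / fact j * kummer_1F1 (real m) (real \<mu>) (q * t))"
    unfolding kummer_1F1_def by (intro sums_mult summable_sums kummer_nat_summable assms)
  hence "(\<lambda>n. if n < j then 0 else ?f (n - j)) sums (p ^ m * t ^ j / fact j * kummer_1F1 (real m) (real \<mu>) (q * t))"
    by (rule sums_shift_if)
  also have "(\<lambda>n. if n < j then 0 else ?f (n - j)) = (\<lambda>n. fps_nth (mix_fps \<kappa> \<mu> m) (Suc n) * t ^ n / fact n)"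
    (is "?l = ?r")
  proof
    fix n
    show "?l n = ?r n"
    proof (cases "n < j")
      case True
      hence "Suc n < \<mu>" by (simp add: ij(2))
      with True show ?thesis using assms(2)
        by (simp add: mix_fps_def nth_X_power_mult_inverse_power del: power_Suc)
    next
      case False
      then obtain k where k: "n = j + k" by (metis le_add_diff_inverse not_less)
      have "?l n = p ^ m * t ^ j / fact j * (real ((i + k) choose k) * (fact k * fact j / fact (j + k)) * (q * t) ^ k / fact k)"
        unfolding ij kummer_nat_coeff k by simp
      also have "\<dots> = p ^ m * (real ((i + k) choose k) * q ^ k) * t ^ n / fact n"
        by (simp add: k power_add power_mult_distrib)
      also have "\<dots> = ?r n"
        using assms by (simp add: mix_fps_def nth_X_power_mult_inverse_power p_def q_def k) (simp add: ij)
      finally show ?thesis .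
    qed
  qed
  finally show ?thesis unfolding borel_sums_def p_def q_def ij(2) by simp
qed

lemma mix_shape_pos:
  assumes "\<mu> > 0" "i \<le> mix_M \<mu> m"
  shows "mix_shape \<mu> m i > 0"
  using assms by (auto simp: mix_shape_def mix_M_def split: if_splits)

lemma mix_Omega_pos:
  assumes "g > 0" "\<kappa> \<ge> 0" "\<mu> > 0" "m > 0"
  shows "mix_Omega g \<kappa> \<mu> m i > 0"
  using assms by (auto simp: mix_Omega_def mix_Delta1_def mix_Delta2_def add_nonneg_pos)

text \<open>The Borel sum of \<open>mix_fps\<close> is computed twice, once as a Kummer function and
  once term by term through \<open>mix_fps_expansion\<close>; both values agree by uniqueness of the
  sum.\<close>

lemma kms_density_mixture:
  assumes "g > 0" "\<kappa> \<ge> 0" "\<mu> > 0" "m > 0" "\<kappa> = 0 \<longrightarrow> \<mu> \<le> m" "x > 0"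
  shows "kms_density g \<kappa> (real \<mu>) (real m) x = (\<Sum>i = 0..mix_M \<mu> m.
    mix_C \<kappa> \<mu> m i * erlang_density (mix_shape \<mu> m i - 1) (1 / mix_Omega g \<kappa> \<mu> m i) x)"
proof -
  define a where "a = real \<mu> * (1 + \<kappa>) / g"
  define p q where "p = mix_p \<kappa> \<mu> m" and "q = mix_q \<kappa> \<mu> m"
  define E where "E i = erlang_density (mix_shape \<mu> m i - 1) (1 / mix_Omega g \<kappa> \<mu> m i) x" for i
  have a: "a > 0" using assms by (simp add: a_def)
  have pq: "p + q = 1" using assms by (simp add: p_def q_def mix_p_plus_q)
  have D: "1 / mix_Delta1 g \<kappa> \<mu> m = a" "1 / mix_Delta2 g \<kappa> \<mu> m = p * a"
    by (simp_all add: a_def mix_Delta1_def mix_Delta2_def p_def mix_p_def)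
  \<comment> \<open>The factor exp(a x) / a strips the prefactor a exp(-a x) shared by the density
    and its Gamma terms; what remains is a power series in a x.\<close>
  have E: "borel_sums (mix_base \<kappa> \<mu> m i ^ mix_shape \<mu> m i) (a * x) (exp (a * x) / a * E i)"
    if i: "i \<le> mix_M \<mu> m" for i
  proof (cases "m < \<mu> \<and> i \<le> \<mu> - m")
    case True
    have "E i = a * (a * x) ^ (mix_shape \<mu> m i - 1) / fact (mix_shape \<mu> m i - 1) * exp (- (a * x))"
      using True assms unfolding E_def by (simp only: mix_Omega_def D if_True simp_thms erlang_density_eq)
    hence "exp (a * x) / a * E i = (a * x) ^ (mix_shape \<mu> m i - 1) / fact (mix_shape \<mu> m i - 1)"
      using a by (simp add: exp_minus)
    thus ?thesis using True borel_sums_X_power[OF mix_shape_pos[OF assms(3) i], of "a * x"]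
      by (simp add: mix_base_def)
  next
    case False
    have "E i = a * exp (- (a * x)) * (p ^ mix_shape \<mu> m i * (a * x) ^ (mix_shape \<mu> m i - 1) /
        fact (mix_shape \<mu> m i - 1) * exp (q * (a * x)))"
      using False erlang_density_scaled_eq[OF assms(6) mix_shape_pos[OF assms(3) i] pq, of a]
      by (auto simp: E_def mix_Omega_def D)
    hence "exp (a * x) / a * E i = p ^ mix_shape \<mu> m i * (a * x) ^ (mix_shape \<mu> m i - 1) /
        fact (mix_shape \<mu> m i - 1) * exp (q * (a * x))"
      using a by (simp add: exp_minus)
    thus ?thesis using False borel_sums_W_power[OF mix_shape_pos[OF assms(3) i], of p q "a * x"]
      by (auto simp: mix_base_def p_def q_def)
  qed
  have "borel_sums (mix_fps \<kappa> \<mu> m) (a * x) (\<Sum>i = 0..mix_M \<mu> m. mix_C \<kappa> \<mu> m i * (exp (a * x) / a * E i))"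
    unfolding mix_fps_expansion[OF assms(2,4,5), symmetric]
    by (intro borel_sums_sum borel_sums_const_mult E) auto
  from borel_sums_unique[OF borel_sums_kummer[OF assms(3,4)] this]
  have "kms_density g \<kappa> (real \<mu>) (real m) x =
      a * exp (- (a * x)) * (\<Sum>i = 0..mix_M \<mu> m. mix_C \<kappa> \<mu> m i * (exp (a * x) / a * E i))"
    unfolding kms_density_eq[OF assms(1-4,6)] a_def by simp
  also have "\<dots> = (\<Sum>i = 0..mix_M \<mu> m. mix_C \<kappa> \<mu> m i * E i)"
    unfolding sum_distrib_left using a by (intro sum.cong) (auto simp: exp_minus)
  finally show ?thesis unfolding E_def .
qed

subsection \<open>Density of a product\<close>

text \<open>For fixed x > 0, scaling by z = x y produces the Jacobian 1 / x, and Tonelli's theorem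
  exchanges the order of integration. \<open>conv\<close> identifies the real-valued
  \<open>h\<close> with the resulting nonnegative integral.\<close>

lemma distr_mult_density:
  fixes f f' :: "real \<Rightarrow> real"
  assumes [measurable]: "f \<in> borel_measurable borel" "f' \<in> borel_measurable borel"
    and nonneg: "\<And>x. 0 \<le> f x" "\<And>x. 0 \<le> f' x"
    and zero: "\<And>x. x < 0 \<Longrightarrow> f x = 0" "\<And>x. x < 0 \<Longrightarrow> f' x = 0"
    and prob: "prob_space (density lborel f')"
    and conv: "\<And>z. z > 0 \<Longrightarrow> mult_convolvable f f' z"
    and h: "\<And>z. h z = (if z > 0 then mult_conv f f' z else 0)"
  shows "h \<in> borel_measurable borel" "\<And>z. 0 \<le> h z"
    "distr (density lborel f \<Otimes>\<^sub>M density lborel f') borel (\<lambda>(x, y). x * y) = density lborel h"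
proof -
  interpret D': prob_space "density lborel (\<lambda>x. ennreal (f' x))" by (rule prob)
  have h_eq: "h z = (if z > 0 then LBINT x. indicator {0<..} x * (f x * f' (z / x) / x) else 0)" for z
    by (simp add: h mult_conv_def set_lebesgue_integral_def)
  show h_meas [measurable]: "h \<in> borel_measurable borel"
    unfolding h_eq[abs_def] by measurable
  have nn: "0 \<le> indicator {0<..} x * (f x * f' (z / x) / x)" for x z :: real
    by (auto intro!: divide_nonneg_nonneg mult_nonneg_nonneg nonneg simp: indicator_def)
  show "0 \<le> h z" for z
    unfolding h_eq by (cases "z > 0") (simp_all only: if_True if_False order_refl integral_nonneg_AE[OF AE_I2[OF nn]])
  have h_nn: "ennreal (h z) = (\<integral>\<^sup>+x. indicator {0<..} x * ennreal (f x * f' (z / x) / x) \<partial>lborel)" if "z > 0" for z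
  proof -
    have "integrable lborel (\<lambda>x. indicator {0<..} x * (f x * f' (z / x) / x))"
      using conv[OF that] by (simp add: mult_convolvable_def set_integrable_def)
    hence "(\<integral>\<^sup>+x. ennreal (indicator {0<..} x * (f x * f' (z / x) / x)) \<partial>lborel) = ennreal (h z)"
      unfolding h_eq using that
      by (subst nn_integral_eq_integral) (use nn in auto)
    also have "(\<lambda>x. ennreal (indicator {0<..} x * (f x * f' (z / x) / x))) =
        (\<lambda>x. indicator {0<..} x * ennreal (f x * f' (z / x) / x))"
      by (auto simp: indicator_def fun_eq_iff)
    finally show ?thesis ..
  qed
  have inner: "(\<integral>\<^sup>+y. ennreal (f' y) * indicator A (x * y) \<partial>lborel) =
      (\<integral>\<^sup>+z. ennreal (f' (z / x) / x) * indicator A z \<partial>lborel)"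
    if x: "x > 0" and [measurable]: "A \<in> sets borel" for x A
  proof -
    have "(\<integral>\<^sup>+z. ennreal (f' (z / x) / x) * indicator A z \<partial>lborel) =
        ennreal x * (\<integral>\<^sup>+y. ennreal (f' y / x) * indicator A (x * y) \<partial>lborel)"
      by (subst nn_integral_real_affine[where c = x and t = 0]) (use x in auto)
    also have "\<dots> = (\<integral>\<^sup>+y. ennreal x * (ennreal (f' y / x) * indicator A (x * y)) \<partial>lborel)"
      by (rule nn_integral_cmult[symmetric]) measurable
    also have "\<dots> = (\<integral>\<^sup>+y. ennreal (f' y) * indicator A (x * y) \<partial>lborel)"
      using x nonneg by (intro nn_integral_cong) (simp add: mult.assoc[symmetric] ennreal_mult''[symmetric])
    finally show ?thesis ..
  qed
  show "distr (density lborel f \<Otimes>\<^sub>M density lborel f') borel (\<lambda>(x, y). x * y) = density lborel h"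
    (is "?P = _")
  proof (rule measure_eqI)
    fix A assume "A \<in> sets ?P"
    hence A [measurable]: "A \<in> sets borel" by simp
    have "emeasure ?P A =
        (\<integral>\<^sup>+p. indicator A (fst p * snd p) \<partial>(density lborel f \<Otimes>\<^sub>M density lborel f'))"
      by (subst nn_integral_indicator[symmetric], simp, subst nn_integral_distr) (auto simp: case_prod_beta)
    also have "\<dots> = (\<integral>\<^sup>+x. \<integral>\<^sup>+y. indicator A (x * y) \<partial>density lborel f' \<partial>density lborel f)"
      by (subst D'.nn_integral_fst[symmetric]) auto
    also have "\<dots> = (\<integral>\<^sup>+x. ennreal (f x) * (\<integral>\<^sup>+y. ennreal (f' y) * indicator A (x * y) \<partial>lborel) \<partial>lborel)"
      by (simp add: nn_integral_density D'.borel_measurable_nn_integral)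
    also have "\<dots> = (\<integral>\<^sup>+x. \<integral>\<^sup>+z. indicator {0<..} x * ennreal (f x * f' (z / x) / x) * indicator A z \<partial>lborel \<partial>lborel)"
    proof (rule nn_integral_cong_AE)
      show "AE x in lborel. ennreal (f x) * (\<integral>\<^sup>+y. ennreal (f' y) * indicator A (x * y) \<partial>lborel) =
        (\<integral>\<^sup>+z. indicator {0<..} x * ennreal (f x * f' (z / x) / x) * indicator A z \<partial>lborel)"
        \<comment> \<open>An Erlang density of shape 1 is positive at 0, so \<open>zero\<close>
          covers negative arguments only and the point 0 is discarded as a null set.\<close>
        using AE_lborel_singleton[of 0]
      proof eventually_elim
        case (elim x)
        show ?case
        proof (cases "x > 0")
          case True
          have "ennreal (f x) * (\<integral>\<^sup>+z. ennreal (f' (z / x) / x) * indicator A z \<partial>lborel) =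
             (\<integral>\<^sup>+z. ennreal (f x) * (ennreal (f' (z / x) / x) * indicator A z) \<partial>lborel)"
            by (rule nn_integral_cmult[symmetric]) measurable
          also have "\<dots> = (\<integral>\<^sup>+z. indicator {0<..} x * ennreal (f x * f' (z / x) / x) * indicator A z \<partial>lborel)"
            using True nonneg by (intro nn_integral_cong) (simp add: mult.assoc[symmetric] ennreal_mult'[symmetric])
          finally show ?thesis unfolding inner[OF True A] .
        next
          case False
          with elim zero show ?thesis by simp
        qed
      qed
    qed
    also have "\<dots> = (\<integral>\<^sup>+z. \<integral>\<^sup>+x. indicator {0<..} x * ennreal (f x * f' (z / x) / x) * indicator A z \<partial>lborel \<partial>lborel)"
      by (rule lborel_pair.Fubini') measurable
    also have "\<dots> = (\<integral>\<^sup>+z. ennreal (h z) * indicator A z \<partial>lborel)"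
    proof (rule nn_integral_cong_AE)
      show "AE z in lborel. (\<integral>\<^sup>+x. indicator {0<..} x * ennreal (f x * f' (z / x) / x) * indicator A z \<partial>lborel) =
          ennreal (h z) * indicator A z"
        using AE_lborel_singleton[of 0]
      proof eventually_elim
        case (elim z)
        show ?case
        proof (cases "z > 0")
          case True
          show ?thesis unfolding h_nn[OF True] by (rule nn_integral_multc) measurable
        next
          case False
          with elim have "z < 0" by simp
          hence "indicator {0<..} x * ennreal (f x * f' (z / x) / x) = 0" for x
            by (auto simp: indicator_def divide_neg_pos zero)
          thus ?thesis unfolding h using False by (simp only: mult_zero_left nn_integral_const if_False ennreal_0)
        qed
      qed
    qed
    also have "\<dots> = emeasure (density lborel h) A"
      by (rule emeasure_density[symmetric]) auto
    finally show "emeasure ?P A = emeasure (density lborel h) A" .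
  qed simp
qed

subsection \<open>Dependence on the shape parameter\<close>

text \<open>The factor exp(-a x) must beat the growth of the Kummer factor with a margin uniform in
  \<kappa>. This works because q stays away from 1 on a bounded range of \<kappa>.\<close>

lemma kms_density_erlang_bound:
  assumes g: "g > 0" and \<mu>: "\<mu> > 0" and m: "m > 0" and K: "K \<ge> 0"
  obtains B l where "l > 0"
    "\<And>\<kappa> x. 0 \<le> \<kappa> \<Longrightarrow> \<kappa> \<le> K \<Longrightarrow> x > 0 \<Longrightarrow>
       0 \<le> kms_density g \<kappa> (real \<mu>) (real m) x \<and>
       kms_density g \<kappa> (real \<mu>) (real m) x \<le> B * erlang_density (\<mu> - 1) l x"
proof -
  \<comment> \<open>p decreases in \<kappa>, so \<open>P\<close> is its least value and q \<le> 1 -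
    P. Since (1 - P/2)^2 \<ge> 1 - P, the choice of \<open>y\<close> gives q / y \<le> 1 - P/2.
    Decay of rate at least (P/2) a survives, and a \<ge> \<mu> / g yields \<open>l\<close>.\<close>
  define P where "P = mix_p K \<mu> m"
  define y where "y = 1 - P / 2"
  define A where "A = real \<mu> * (1 + K) / g"
  define l where "l = P / 2 * (real \<mu> / g)"
  define C where "C = 1 / (1 - y) ^ (m - 1)"
  have P: "0 < P" "P \<le> 1"
    using mix_p_pos[OF K m, of \<mu>] mix_p_plus_q[OF K m, of \<mu>] mix_q_nonneg[OF K, of \<mu> m]
    by (auto simp: P_def)
  hence y: "0 < y" "y < 1" by (auto simp: y_def)
  hence C: "C \<ge> 0" by (simp add: C_def)
  have l: "l > 0" using P g \<mu> by (simp add: l_def)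
  have A: "A > 0" using g \<mu> K by (simp add: A_def)
  have main: "0 \<le> kms_density g \<kappa> (real \<mu>) (real m) x \<and>
       kms_density g \<kappa> (real \<mu>) (real m) x \<le> C * (A / l) ^ \<mu> * erlang_density (\<mu> - 1) l x"
    if \<kappa>: "0 \<le> \<kappa>" "\<kappa> \<le> K" and x: "x > 0" for \<kappa> x
  proof -
    define a p q where "a = real \<mu> * (1 + \<kappa>) / g" and "p = mix_p \<kappa> \<mu> m" and "q = mix_q \<kappa> \<mu> m"
    have p: "0 < p" and q: "0 \<le> q" and pq: "p + q = 1"
      using \<kappa> m by (auto simp: p_def q_def mix_p_pos mix_q_nonneg mix_p_plus_q)
    have "P \<le> p" unfolding P_def p_def mix_p_def
      using \<kappa> m by (intro divide_left_mono add_right_mono mult_left_mono mult_pos_pos)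
        (auto intro!: add_nonneg_pos)
    hence q_le: "q \<le> 1 - P" using pq by simp
    have a: "0 < a" "a \<le> A" "real \<mu> / g \<le> a"
      using \<kappa> g \<mu> by (auto simp: a_def A_def intro!: divide_right_mono mult_left_mono)
    have qy: "q / y \<le> 1 - P / 2"
    proof -
      have "(1 - P / 2) * y = 1 - P + (P / 2)\<^sup>2" by (simp add: y_def power2_eq_square algebra_simps)
      hence "q \<le> (1 - P / 2) * y" using q_le zero_le_power2[of "P / 2"] by linarith
      thus ?thesis using y by (simp add: pos_divide_le_eq)
    qed
    have "l * x \<le> (P / 2) * a * x"
      unfolding l_def using a P x by (intro mult_right_mono mult_left_mono) auto
    also have "\<dots> \<le> (1 - q / y) * a * x"
      using qy a x by (intro mult_right_mono) auto
    also have "\<dots> = a * x - q * (a * x) / y" by (simp add: algebra_simps)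
    finally have expo: "- (a * x) + q * (a * x) / y \<le> - (l * x)" by simp
    have ker: "kummer_1F1 (real m) (real \<mu>) (q * (a * x)) \<le> C * exp (q * (a * x) / y)"
      "0 \<le> kummer_1F1 (real m) (real \<mu>) (q * (a * x))"
      unfolding C_def using q a x by (intro kummer_nat_le[OF y m \<mu>] mult_nonneg_nonneg; simp)+
    have eq: "kms_density g \<kappa> (real \<mu>) (real m) x =
      a * exp (- (a * x)) * (p ^ m * (a * x) ^ (\<mu> - 1) / fact (\<mu> - 1) *
        kummer_1F1 (real m) (real \<mu>) (q * (a * x)))"
      unfolding a_def p_def q_def by (rule kms_density_eq[OF g \<kappa>(1) \<mu> m x])
    have nonneg: "0 \<le> kms_density g \<kappa> (real \<mu>) (real m) x"
      unfolding eq using a p x ker(2) by simp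
    have "kms_density g \<kappa> (real \<mu>) (real m) x \<le>
      A * exp (- (a * x)) * (1 * (A * x) ^ (\<mu> - 1) / fact (\<mu> - 1) * (C * exp (q * (a * x) / y)))"
      unfolding eq using a p q pq x ker A C
      by (intro mult_mono divide_right_mono power_mono power_le_one) auto
    also have "\<dots> = C * A * (A * x) ^ (\<mu> - 1) / fact (\<mu> - 1) * exp (- (a * x) + q * (a * x) / y)"
      unfolding exp_add by simp
    also have "\<dots> \<le> C * A * (A * x) ^ (\<mu> - 1) / fact (\<mu> - 1) * exp (- (l * x))"
      using expo A C x by (intro mult_left_mono) auto
    also have "\<dots> = C * (A / l) ^ \<mu> * erlang_density (\<mu> - 1) l x"
    proof -
      obtain j where "\<mu> = Suc j" using \<mu> by (metis gr0_implies_Suc)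
      thus ?thesis unfolding erlang_density_eq[OF x] using l
        by (simp add: power_mult_distrib power_divide field_simps)
    qed
    finally show ?thesis using nonneg by blast
  qed
  show ?thesis by (rule that[OF l main])
qed

lemma borel_measurable_kms_density [measurable]:
  assumes "m > 0" "\<mu> > 0"
  shows "kms_density g \<kappa> (real \<mu>) (real m) \<in> borel_measurable borel"
proof -
  have [measurable]: "kummer_1F1 (real m) (real \<mu>) \<in> borel_measurable borel"
    by (intro borel_measurable_continuous_onI continuous_at_imp_continuous_on ballI isCont_kummer_nat assms)
  show ?thesis unfolding kms_density_def[abs_def] by measurable
qed

text \<open>The endpoint 0 is included: the singularity at \<kappa> = 0 sits in the mixture weights
  and not in the density.\<close>

lemma continuous_on_kms_density_kappa:
  assumes "g > 0" "\<mu> > 0" "m > 0" "x > 0"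
  shows "continuous_on {0..} (\<lambda>\<kappa>. kms_density g \<kappa> (real \<mu>) (real m) x)"
proof -
  have K: "continuous_on UNIV (kummer_1F1 (real m) (real \<mu>))"
    by (intro continuous_at_imp_continuous_on ballI isCont_kummer_nat assms)
  have pos: "real \<mu> * \<kappa> + real m > 0" if "\<kappa> \<ge> 0" for \<kappa>
    using that assms by (simp add: add_nonneg_pos)
  have "Gamma (real \<mu>) > 0" using assms by (intro Gamma_real_pos) simp
  hence G: "Gamma (real \<mu>) \<noteq> 0" by simp
  have "continuous_on {0..} (\<lambda>\<kappa>. real \<mu> powr real \<mu> * real m powr real m * (1 + \<kappa>) powr real \<mu> /
      (Gamma (real \<mu>) * g * (real \<mu> * \<kappa> + real m) powr real m) * (x / g) powr (real \<mu> - 1) *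
      exp (- (real \<mu> * (1 + \<kappa>) * x / g)) *
      kummer_1F1 (real m) (real \<mu>) ((real \<mu>)\<^sup>2 * \<kappa> * (1 + \<kappa>) / (real \<mu> * \<kappa> + real m) * (x / g)))"
    using assms pos G
    by (intro continuous_intros continuous_on_compose2[OF K]) (auto simp: less_imp_neq[symmetric] dest: pos)
  thus ?thesis using assms by (simp add: kms_density_def)
qed

text \<open>The majorant is a multiple of the convolution integrand of two Erlang densities,
  integrable by \<open>mult_conv_erlang\<close>. Its uniformity over a box of parameters serves both
  convolvability and dominated convergence.\<close>

lemma kms_density_product_dominated:
  assumes "g > 0" "\<mu> > 0" "m > 0" "g' > 0" "\<mu>' > 0" "m' > 0" "z > 0" "K \<ge> 0" "K' \<ge> 0"
  obtains w where "integrable lborel w"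
    "\<And>\<kappa> \<kappa>' x. 0 \<le> \<kappa> \<Longrightarrow> \<kappa> \<le> K \<Longrightarrow> 0 \<le> \<kappa>' \<Longrightarrow> \<kappa>' \<le> K' \<Longrightarrow>
       norm (indicator {0<..} x *\<^sub>R (kms_density g \<kappa> (real \<mu>) (real m) x *
         kms_density g' \<kappa>' (real \<mu>') (real m') (z / x) / x)) \<le> w x"
proof -
  obtain B l where l: "l > 0" and B: "\<And>\<kappa> x. 0 \<le> \<kappa> \<Longrightarrow> \<kappa> \<le> K \<Longrightarrow> x > 0 \<Longrightarrow>
       0 \<le> kms_density g \<kappa> (real \<mu>) (real m) x \<and>
       kms_density g \<kappa> (real \<mu>) (real m) x \<le> B * erlang_density (\<mu> - 1) l x"
    using kms_density_erlang_bound[OF assms(1,2,3,8)] by metis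
  obtain B' l' where l': "l' > 0" and B': "\<And>\<kappa> x. 0 \<le> \<kappa> \<Longrightarrow> \<kappa> \<le> K' \<Longrightarrow> x > 0 \<Longrightarrow>
       0 \<le> kms_density g' \<kappa> (real \<mu>') (real m') x \<and>
       kms_density g' \<kappa> (real \<mu>') (real m') x \<le> B' * erlang_density (\<mu>' - 1) l' x"
    using kms_density_erlang_bound[OF assms(4,5,6,9)] by metis
  define w where "w = (\<lambda>x. B * B' * (indicator {0<..} x *\<^sub>R
      (erlang_density (\<mu> - 1) l x * erlang_density (\<mu>' - 1) l' (z / x) / x)))"
  have "integrable lborel w"
    using mult_conv_erlang(1)[of \<mu> \<mu>' "1 / l" "1 / l'" z] assms l l'
    unfolding w_def mult_convolvable_def set_integrable_def
    by (intro integrable_mult_right) simp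
  moreover have "norm (indicator {0<..} x *\<^sub>R (kms_density g \<kappa> (real \<mu>) (real m) x *
         kms_density g' \<kappa>' (real \<mu>') (real m') (z / x) / x)) \<le> w x"
    if "0 \<le> \<kappa>" "\<kappa> \<le> K" "0 \<le> \<kappa>'" "\<kappa>' \<le> K'" for \<kappa> \<kappa>' x
  proof (cases "x > 0")
    case True
    note 1 = B[OF that(1,2) True]
    have "z / x > 0" using True assms by simp
    note 2 = B'[OF that(3,4) this]
    have "kms_density g \<kappa> (real \<mu>) (real m) x * kms_density g' \<kappa>' (real \<mu>') (real m') (z / x) / x
      \<le> (B * erlang_density (\<mu> - 1) l x) * (B' * erlang_density (\<mu>' - 1) l' (z / x)) / x"
      using 1 2 True by (intro divide_right_mono mult_mono) (auto intro: order_trans)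
    thus ?thesis using 1 2 True by (simp add: w_def mult_ac)
  qed (simp add: w_def)
  ultimately show ?thesis by (rule that)
qed

lemma mult_convolvable_kms:
  assumes "g > 0" "\<mu> > 0" "m > 0" "g' > 0" "\<mu>' > 0" "m' > 0" "z > 0" "\<kappa> \<ge> 0" "\<kappa>' \<ge> 0"
  shows "mult_convolvable (kms_density g \<kappa> (real \<mu>) (real m)) (kms_density g' \<kappa>' (real \<mu>') (real m')) z"
proof -
  note [measurable] = borel_measurable_kms_density[OF assms(3,2)] borel_measurable_kms_density[OF assms(6,5)]
  obtain w where w: "integrable lborel w" 
    "\<And>x. norm (indicator {0<..} x *\<^sub>R (kms_density g \<kappa> (real \<mu>) (real m) x *
         kms_density g' \<kappa>' (real \<mu>') (real m') (z / x) / x)) \<le> w x"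
    using kms_density_product_dominated[OF assms] assms(8,9) by (metis order_refl)
  show ?thesis unfolding mult_convolvable_def set_integrable_def
  proof (rule Bochner_Integration.integrable_bound[OF w(1)])
    show "AE x in lborel. norm (indicator {0<..} x *\<^sub>R (kms_density g \<kappa> (real \<mu>) (real m) x *
         kms_density g' \<kappa>' (real \<mu>') (real m') (z / x) / x)) \<le> norm (w x)"
      using w(2) by (intro AE_I2) (metis abs_ge_self order_trans real_norm_def)
  qed measurable
qed

lemma mult_conv_kms_tendsto:
  assumes "g > 0" "\<mu> > 0" "m > 0" "g' > 0" "\<mu>' > 0" "m' > 0" "z > 0" "\<kappa> \<ge> 0" "\<kappa>' \<ge> 0"
  shows "((\<lambda>(k, k'). mult_conv (kms_density g k (real \<mu>) (real m)) (kms_density g' k' (real \<mu>') (real m')) z)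
    \<longlongrightarrow> mult_conv (kms_density g \<kappa> (real \<mu>) (real m)) (kms_density g' \<kappa>' (real \<mu>') (real m')) z)
    (at (\<kappa>, \<kappa>') within {0<..} \<times> {0<..})"
  unfolding tendsto_at_iff_sequentially
proof (intro allI impI)
  fix S :: "nat \<Rightarrow> real \<times> real"
  assume S: "\<forall>i. S i \<in> {0<..} \<times> {0<..} - {(\<kappa>, \<kappa>')}" and lim: "S \<longlonglongrightarrow> (\<kappa>, \<kappa>')"
  define k k' where "k = (\<lambda>n. fst (S n))" and "k' = (\<lambda>n. snd (S n))"
  have pos: "0 < k n" "0 < k' n" for n
    using S[rule_format, of n] by (cases "S n"; simp add: k_def k'_def)+
  have k: "k \<longlonglongrightarrow> \<kappa>" "k' \<longlonglongrightarrow> \<kappa>'"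
    using tendsto_fst[OF lim] tendsto_snd[OF lim] by (simp_all add: k_def k'_def)
  \<comment> \<open>Convergent sequences are bounded; the bounds give a box on which one majorant
    dominates every term.\<close>
  obtain K K' where K: "\<And>n. norm (k n) \<le> K" "\<And>n. norm (k' n) \<le> K'" 
    using k by (metis convergentI convergent_imp_Bseq BseqE)
  have K_nonneg: "K \<ge> 0" "K' \<ge> 0" using K norm_ge_zero order_trans by blast+
  note [measurable] = borel_measurable_kms_density[OF assms(3,2)] borel_measurable_kms_density[OF assms(6,5)]
  define F where "F = (\<lambda>\<kappa> \<kappa>' x. indicator {0<..} x *\<^sub>R (kms_density g \<kappa> (real \<mu>) (real m) x *
         kms_density g' \<kappa>' (real \<mu>') (real m') (z / x) / x))"
  obtain w where w: "integrable lborel w" "\<And>\<kappa> \<kappa>' x. 0 \<le> \<kappa> \<Longrightarrow> \<kappa> \<le> K \<Longrightarrow> 0 \<le> \<kappa>' \<Longrightarrow> \<kappa>' \<le> K' \<Longrightarrow>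
       norm (F \<kappa> \<kappa>' x) \<le> w x"
    using kms_density_product_dominated[OF assms(1-7) K_nonneg] unfolding F_def by metis
  have "(\<lambda>n. integral\<^sup>L lborel (F (k n) (k' n))) \<longlonglongrightarrow> integral\<^sup>L lborel (F \<kappa> \<kappa>')"
  proof (rule integral_dominated_convergence[OF _ _ w(1)])
    show "AE x in lborel. norm (F (k n) (k' n) x) \<le> w x" for n
      using K[of n] pos[of n] by (intro AE_I2 w(2)) auto
    show "AE x in lborel. (\<lambda>n. F (k n) (k' n) x) \<longlonglongrightarrow> F \<kappa> \<kappa>' x"
    proof (rule AE_I2)
      fix x
      show "(\<lambda>n. F (k n) (k' n) x) \<longlonglongrightarrow> F \<kappa> \<kappa>' x"
      proof (cases "x > 0")
        case True
        hence zx: "z / x > 0" using assms by simp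
        have 1: "(\<lambda>n. kms_density g (k n) (real \<mu>) (real m) x) \<longlonglongrightarrow> kms_density g \<kappa> (real \<mu>) (real m) x"
          by (rule continuous_on_tendsto_compose[OF continuous_on_kms_density_kappa[OF assms(1-3) True] k(1)])
             (use assms pos in \<open>auto intro!: always_eventually less_imp_le\<close>)
        have 2: "(\<lambda>n. kms_density g' (k' n) (real \<mu>') (real m') (z / x)) \<longlonglongrightarrow>
            kms_density g' \<kappa>' (real \<mu>') (real m') (z / x)"
          by (rule continuous_on_tendsto_compose[OF continuous_on_kms_density_kappa[OF assms(4-6) zx] k(2)])
             (use assms pos in \<open>auto intro!: always_eventually less_imp_le\<close>)
        show ?thesis unfolding F_def using True by (intro tendsto_intros 1 2) auto
      qed (simp add: F_def)
    qed
  qed (unfold F_def, measurable)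
  thus "((\<lambda>(k, k'). mult_conv (kms_density g k (real \<mu>) (real m)) (kms_density g' k' (real \<mu>') (real m')) z) \<circ> S)
    \<longlonglongrightarrow> mult_conv (kms_density g \<kappa> (real \<mu>) (real m)) (kms_density g' \<kappa>' (real \<mu>') (real m')) z"
    by (simp add: comp_def case_prod_beta mult_conv_def set_lebesgue_integral_def F_def k_def k'_def)
qed

text \<open>Bilinearity of the convolution; each Erlang pair is integrable on its own, so the signed
  sums may leave the integral.\<close>

lemma mult_conv_kms_nondegenerate:
  assumes "g > 0" "\<kappa> \<ge> 0" "\<mu> > 0" "m > 0" "\<kappa> = 0 \<longrightarrow> \<mu> \<le> m"
    and "g' > 0" "\<kappa>' \<ge> 0" "\<mu>' > 0" "m' > 0" "\<kappa>' = 0 \<longrightarrow> \<mu>' \<le> m'" and z: "z > 0"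
  shows "mult_conv (kms_density g \<kappa> (real \<mu>) (real m)) (kms_density g' \<kappa>' (real \<mu>') (real m')) z =
    product_mixture g \<kappa> \<mu> m g' \<kappa>' \<mu>' m' z"
proof -
  define E where "E = (\<lambda>j. erlang_density (mix_shape \<mu> m j - 1) (1 / mix_Omega g \<kappa> \<mu> m j))"
  define E' where "E' = (\<lambda>j. erlang_density (mix_shape \<mu>' m' j - 1) (1 / mix_Omega g' \<kappa>' \<mu>' m' j))"
  define C C' where "C = mix_C \<kappa> \<mu> m" and "C' = mix_C \<kappa>' \<mu>' m'"
  note erl = mult_conv_erlang[OF mix_shape_pos[OF assms(3)] mix_shape_pos[OF assms(8)]
      mix_Omega_pos[OF assms(1-4)] mix_Omega_pos[OF assms(6-9)] z]
  have int: "integrable lborel (\<lambda>x. indicator {0<..} x *\<^sub>R (E j x * E' h (z / x) / x))"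
    if "j \<le> mix_M \<mu> m" "h \<le> mix_M \<mu>' m'" for j h
    using erl(1)[OF that] unfolding mult_convolvable_def set_integrable_def E_def E'_def .
  have "mult_conv (kms_density g \<kappa> (real \<mu>) (real m)) (kms_density g' \<kappa>' (real \<mu>') (real m')) z =
    (LBINT x. (\<Sum>j = 0..mix_M \<mu> m. \<Sum>h = 0..mix_M \<mu>' m'. C j * C' h * (indicator {0<..} x *\<^sub>R (E j x * E' h (z / x) / x))))"
    unfolding mult_conv_def set_lebesgue_integral_def
  proof (rule Bochner_Integration.integral_cong[OF refl])
    fix x :: real
    show "indicator {0<..} x *\<^sub>R (kms_density g \<kappa> (real \<mu>) (real m) x * kms_density g' \<kappa>' (real \<mu>') (real m') (z / x) / x) =
      (\<Sum>j = 0..mix_M \<mu> m. \<Sum>h = 0..mix_M \<mu>' m'. C j * C' h * (indicator {0<..} x *\<^sub>R (E j x * E' h (z / x) / x)))"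
    proof (cases "x > 0")
      case True
      hence "z / x > 0" using z by simp
      thus ?thesis using True
        by (simp add: kms_density_mixture[OF assms(1-5) True] kms_density_mixture[OF assms(6-10)]
           C_def C'_def E_def E'_def sum_product sum_divide_distrib mult_ac)
    qed simp
  qed
  also have "\<dots> = (\<Sum>j = 0..mix_M \<mu> m. LBINT x. (\<Sum>h = 0..mix_M \<mu>' m'.
      C j * C' h * (indicator {0<..} x *\<^sub>R (E j x * E' h (z / x) / x))))"
    by (intro Bochner_Integration.integral_sum Bochner_Integration.integrable_sum integrable_mult_right int) auto
  also have "\<dots> = (\<Sum>j = 0..mix_M \<mu> m. \<Sum>h = 0..mix_M \<mu>' m'.
      LBINT x. C j * C' h * (indicator {0<..} x *\<^sub>R (E j x * E' h (z / x) / x)))"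
    by (intro sum.cong refl Bochner_Integration.integral_sum integrable_mult_right int) auto
  also have "\<dots> = (\<Sum>j = 0..mix_M \<mu> m. \<Sum>h = 0..mix_M \<mu>' m'. C j * C' h * mult_conv (E j) (E' h) z)"
    unfolding mult_conv_def set_lebesgue_integral_def integral_mult_right_zero ..
  also have "\<dots> = product_mixture g \<kappa> \<mu> m g' \<kappa>' \<mu>' m' z"
    unfolding product_mixture_def C_def C'_def E_def E'_def by (intro sum.cong refl) (simp only: atLeastAtMost_iff erl(2))
  finally show ?thesis .
qed

subsection \<open>Mixtures of Gamma-Gamma distributions\<close>

text \<open>Brings measures of sets into real Bochner integrals, where negative weights are
  harmless.\<close>

lemma prob_space_density_measure:
  fixes f :: "real \<Rightarrow> real"
  assumes [measurable]: "f \<in> borel_measurable borel" and nonneg: "\<And>x. 0 \<le> f x"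
    and prob: "prob_space (density lborel f)"
  shows "integrable lborel f"
    and "A \<in> sets borel \<Longrightarrow> measure (density lborel f) A = (LBINT x. f x * indicator A x)"
proof -
  interpret prob_space "density lborel (\<lambda>x. ennreal (f x))" by (rule prob)
  have "(\<integral>\<^sup>+x. ennreal (f x) \<partial>lborel) = 1"
    using emeasure_space_1 by (simp add: emeasure_density)
  thus "integrable lborel f"
    using nonneg by (intro integrableI_nn_integral_finite[where x = 1]) auto
  assume A [measurable]: "A \<in> sets borel"
  have "(LBINT x. f x * indicator A x) = enn2real (\<integral>\<^sup>+x. ennreal (f x * indicator A x) \<partial>lborel)"
    using nonneg by (intro integral_eq_nn_integral) auto
  also have "(\<integral>\<^sup>+x. ennreal (f x * indicator A x) \<partial>lborel) = emeasure (density lborel f) A"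
    by (subst emeasure_density) (auto intro!: nn_integral_cong simp: indicator_def)
  finally show "measure (density lborel f) A = (LBINT x. f x * indicator A x)"
    by (simp add: measure_def)
qed

lemma gamma_gamma_eq_density:
  assumes "a > 0" "b > 0" "v > 0" "w > 0"
  defines "h \<equiv> \<lambda>z. if z > 0 then gamma_gamma_density a v b w z else 0"
  shows "h \<in> borel_measurable borel" "0 \<le> h z" "gamma_gamma a v b w = density lborel h"
    "prob_space (gamma_gamma a v b w)"
proof -
  note prob = prob_space_erlang_density[of "1 / v" "a - 1"] prob_space_erlang_density[of "1 / w" "b - 1"]
  have h: "h z = (if z > 0 then mult_conv (erlang_density (a - 1) (1 / v)) (erlang_density (b - 1) (1 / w)) z else 0)" for z
    unfolding h_def
    by (cases "z > 0") (simp_all only: if_True if_False mult_conv_erlang(2)[OF assms(1-4)])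
  have nonneg: "0 \<le> erlang_density k (1 / u) x" and zero: "x < 0 \<Longrightarrow> erlang_density k (1 / u) x = 0"
    if "u > 0" for k u x
    using that by (simp_all add: erlang_density_def)
  have "prob_space (density lborel (erlang_density (b - 1) (1 / w)))"
    using prob(2) assms(4) by simp
  note * = distr_mult_density[OF borel_measurable_erlang_density borel_measurable_erlang_density
      nonneg[OF assms(3)] nonneg[OF assms(4)] zero[OF assms(3)] zero[OF assms(4)] this
      mult_conv_erlang(1)[OF assms(1-4)] h]
  show "h \<in> borel_measurable borel" "0 \<le> h z" "gamma_gamma a v b w = density lborel h"
    unfolding gamma_gamma_def by (rule *, assumption+)+
  interpret D1: prob_space "density lborel (\<lambda>x. ennreal (erlang_density (a - 1) (1 / v) x))"
    using prob(1) assms by simp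
  interpret D2: prob_space "density lborel (\<lambda>x. ennreal (erlang_density (b - 1) (1 / w) x))"
    using prob(2) assms by simp
  interpret pair_prob_space "density lborel (\<lambda>x. ennreal (erlang_density (a - 1) (1 / v) x))"
     "density lborel (\<lambda>x. ennreal (erlang_density (b - 1) (1 / w) x))" ..
  show "prob_space (gamma_gamma a v b w)"
    unfolding gamma_gamma_def by (intro prob_space_distr) measurable
qed

text \<open>Independence makes the joint law the product measure to which
  \<open>distr_mult_density\<close> applies.\<close>

lemma has_pdf_mult:
  assumes M: "prob_space M" and X: "has_pdf M X f" and X': "has_pdf M X' f'"
    and indep: "prob_space.indep_var M borel X borel X'"
    and [measurable]: "f \<in> borel_measurable borel" "f' \<in> borel_measurable borel"
    and zero: "\<And>x. x < 0 \<Longrightarrow> f x = 0" "\<And>x. x < 0 \<Longrightarrow> f' x = 0"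
    and conv: "\<And>z. z > 0 \<Longrightarrow> mult_convolvable f f' z"
    and h: "\<And>z. h z = (if z > 0 then mult_conv f f' z else 0)"
  shows "has_pdf M (\<lambda>\<omega>. X \<omega> * X' \<omega>) h"
    and "h \<in> borel_measurable borel" "\<And>z. 0 \<le> h z"
    and "distr M borel (\<lambda>\<omega>. X \<omega> * X' \<omega>) = density lborel h"
proof -
  interpret prob_space M by (rule M)
  have nonneg: "\<And>x. 0 \<le> f x" "\<And>x. 0 \<le> f' x" using X X' by (auto simp: has_pdf_def)
  have dX: "distributed M lborel X (\<lambda>x. ennreal (f x))" and dX': "distributed M lborel X' (\<lambda>x. ennreal (f' x))"
    using X X' by (auto simp: has_pdf_def)
  have [measurable]: "X \<in> borel_measurable M" "X' \<in> borel_measurable M"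
    using distributed_measurable[OF dX] distributed_measurable[OF dX'] by simp_all
  have D: "distr M borel X = density lborel f" "distr M borel X' = density lborel f'"
    using distributed_distr_eq_density[OF dX] distributed_distr_eq_density[OF dX']
    by (simp_all cong: distr_cong)
  have prob: "prob_space (density lborel f')"
    unfolding D(2)[symmetric] by (rule prob_space_distr) measurable
  note * = distr_mult_density[OF assms(5,6) nonneg zero prob conv h]
  have "density lborel f \<Otimes>\<^sub>M density lborel f' = distr M (borel \<Otimes>\<^sub>M borel) (\<lambda>\<omega>. (X \<omega>, X' \<omega>))"
    using indep unfolding indep_var_distribution_eq D by simp
  hence "density lborel h = distr (distr M (borel \<Otimes>\<^sub>M borel) (\<lambda>\<omega>. (X \<omega>, X' \<omega>))) borel (\<lambda>(x, y). x * y)"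
    using *(3) by simp
  also have "\<dots> = distr M borel (\<lambda>\<omega>. X \<omega> * X' \<omega>)"
    by (subst distr_distr) (auto simp: comp_def)
  finally show eq: "distr M borel (\<lambda>\<omega>. X \<omega> * X' \<omega>) = density lborel h" ..
  show h_meas [measurable]: "h \<in> borel_measurable borel" by (rule *(1))
  show h_nonneg: "\<And>z. 0 \<le> h z" by (rule *(2))
  have "distr M lborel (\<lambda>\<omega>. X \<omega> * X' \<omega>) = density lborel h"
    unfolding eq[symmetric] by (rule distr_cong) auto
  thus "has_pdf M (\<lambda>\<omega>. X \<omega> * X' \<omega>) h"
    using h_nonneg unfolding has_pdf_def distributed_def by auto
qed

lemma finite_mixture_gamma_gamma:
  assumes I: "finite I" and pos: "\<And>i. i \<in> I \<Longrightarrow> a i > 0 \<and> b i > 0 \<and> v i > 0 \<and> w i > 0"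
    and h: "\<And>z. h z = (if z > 0 then \<Sum>i\<in>I. c i * gamma_gamma_density (a i) (v i) (b i) (w i) z else 0)"
    and h_meas: "h \<in> borel_measurable borel" and h_nonneg: "\<And>z. 0 \<le> h z"
    and N: "N = density lborel h" "prob_space N"
  shows "finite_mixture I c (\<lambda>i. gamma_gamma (a i) (v i) (b i) (w i)) N"
proof -
  define G where "G = (\<lambda>i. gamma_gamma (a i) (v i) (b i) (w i))"
  define e where "e = (\<lambda>i z. if z > 0 then gamma_gamma_density (a i) (v i) (b i) (w i) z else 0)"
  have G: "e i \<in> borel_measurable borel" "\<And>z. 0 \<le> e i z" "G i = density lborel (e i)" "prob_space (G i)"
    if "i \<in> I" for i
    using gamma_gamma_eq_density[of "a i" "b i" "v i" "w i"] pos[OF that] unfolding e_def G_def by auto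
  have h_eq: "h z = (\<Sum>i\<in>I. c i * e i z)" for z
    by (simp add: h e_def)
  have mix: "measure N A = (\<Sum>i\<in>I. c i * measure (G i) A)" if A: "A \<in> sets borel" for A
  proof -
    have int: "integrable lborel (\<lambda>z. e i z * indicator A z)" if i: "i \<in> I" for i
    proof -
      have "integrable lborel (e i)"
        using prob_space_density_measure(1)[OF G(1,2)[OF i]] G(3,4)[OF i] by simp
      thus ?thesis using A by (intro integrable_real_mult_indicator) auto
    qed
    have "measure N A = (LBINT z. h z * indicator A z)"
      using prob_space_density_measure(2)[OF h_meas h_nonneg _ A] N by simp
    also have "\<dots> = (LBINT z. (\<Sum>i\<in>I. c i * (e i z * indicator A z)))"
      by (simp add: h_eq sum_distrib_right mult.assoc)
    also have "\<dots> = (\<Sum>i\<in>I. LBINT z. c i * (e i z * indicator A z))"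
      by (intro Bochner_Integration.integral_sum integrable_mult_right int)
    also have "\<dots> = (\<Sum>i\<in>I. c i * measure (G i) A)"
    proof (intro sum.cong refl)
      fix i assume i: "i \<in> I"
      have "measure (G i) A = (LBINT z. e i z * indicator A z)"
        using prob_space_density_measure(2)[OF G(1,2)[OF i] _ A] G(3,4)[OF i] by simp
      thus "(LBINT z. c i * (e i z * indicator A z)) = c i * measure (G i) A" by simp
    qed
    finally show ?thesis .
  qed
  \<comment> \<open>That the weights add up to 1 is read off from total masses: on the whole line
    the mixture and all its components have measure 1.\<close>
  have "(\<Sum>i\<in>I. c i * measure (G i) UNIV) = measure N (space N)"
    using mix[of UNIV] N(1) by simp
  also have "\<dots> = 1" by (rule prob_space.prob_space[OF N(2)])
  finally have "1 = (\<Sum>i\<in>I. c i * measure (G i) UNIV)" ..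
  also have "\<dots> = sum c I"
  proof (intro sum.cong refl)
    fix i assume i: "i \<in> I"
    have "measure (G i) (space (G i)) = 1" by (rule prob_space.prob_space[OF G(4)[OF i]])
    thus "c i * measure (G i) UNIV = c i" using G(3)[OF i] by simp
  qed
  finally have "sum c I = 1" ..
  with I mix G(4) show ?thesis unfolding finite_mixture_def G_def by blast
qed

theorem proposition1:
  fixes M :: "'a measure" and X X' :: "'a \<Rightarrow> real"
    and g g' \<kappa> \<kappa>' :: real and \<mu> m \<mu>' m' :: nat
  assumes "prob_space M"
    and "g > 0" and "\<kappa> \<ge> 0" and "\<mu> > 0" and "m > 0"
    and "g' > 0" and "\<kappa>' \<ge> 0" and "\<mu>' > 0" and "m' > 0"
    and "squared_kms M X g \<kappa> (real \<mu>) (real m)"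
    and "squared_kms M X' g' \<kappa>' (real \<mu>') (real m')"
    and "prob_space.indep_var M borel X borel X'"
  shows
    \<comment> \<open>All weights are defined unless \<open>\<kappa> = 0 \<and> m < \<mu>\<close> or \<open>\<kappa>' = 0 \<and> m' < \<mu>'\<close>, where they involve
      \<open>0\<close> to a negative power; there the density is the limit of the formula from positive
      \<open>\<kappa>\<close>, \<open>\<kappa>'\<close>.\<close>
    "if (\<kappa> = 0 \<longrightarrow> \<mu> \<le> m) \<and> (\<kappa>' = 0 \<longrightarrow> \<mu>' \<le> m')
     then
       finite_mixture ({0..mix_M \<mu> m} \<times> {0..mix_M \<mu>' m'})
         (\<lambda>(j, h). mix_C \<kappa> \<mu> m j * mix_C \<kappa>' \<mu>' m' h)
         (\<lambda>(j, h). gamma_gamma (mix_shape \<mu> m j) (mix_Omega g \<kappa> \<mu> m j)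
                     (mix_shape \<mu>' m' h) (mix_Omega g' \<kappa>' \<mu>' m' h))
         (distr M borel (\<lambda>\<omega>. X \<omega> * X' \<omega>)) \<and>
       has_pdf M (\<lambda>\<omega>. X \<omega> * X' \<omega>)
         (\<lambda>z. if z > 0 then product_mixture g \<kappa> \<mu> m g' \<kappa>' \<mu>' m' z else 0)
     else
       (\<exists>f. has_pdf M (\<lambda>\<omega>. X \<omega> * X' \<omega>) (\<lambda>z. if z > 0 then f z else 0) \<and>
         (\<forall>z>0. ((\<lambda>(k, k'). product_mixture g k \<mu> m g' k' \<mu>' m' z) \<longlongrightarrow> f z)
                  (at (\<kappa>, \<kappa>') within {0<..} \<times> {0<..})))"
proof -
  let ?D = "\<lambda>k. kms_density g k (real \<mu>) (real m)" and ?D' = "\<lambda>k. kms_density g' k (real \<mu>') (real m')"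
  \<comment> \<open>The convolution involves no mixture weights, so \<open>pdf\<close> covers
    degenerate and nondegenerate parameters alike.\<close>
  define h where "h = (\<lambda>z. if z > 0 then mult_conv (?D \<kappa>) (?D' \<kappa>') z else 0)"
  have X: "has_pdf M X (?D \<kappa>)" and X': "has_pdf M X' (?D' \<kappa>')"
    using assms(10,11) by (auto simp: squared_kms_def)
  note meas = borel_measurable_kms_density[OF assms(5,4)] borel_measurable_kms_density[OF assms(9,8)]
  have zero: "?D \<kappa> x = 0" "?D' \<kappa>' x = 0" if "x < 0" for x
    using that by (auto simp: kms_density_def)
  note conv = mult_convolvable_kms[OF assms(2,4,5,6,8,9) _ assms(3,7)]
  have pdf: "has_pdf M (\<lambda>\<omega>. X \<omega> * X' \<omega>) h" "h \<in> borel_measurable borel" "0 \<le> h z"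
      "distr M borel (\<lambda>\<omega>. X \<omega> * X' \<omega>) = density lborel h" for z
    by (rule has_pdf_mult[OF assms(1) X X' assms(12) meas zero conv fun_cong[OF h_def]], assumption+)+
  show ?thesis
  proof (cases "(\<kappa> = 0 \<longrightarrow> \<mu> \<le> m) \<and> (\<kappa>' = 0 \<longrightarrow> \<mu>' \<le> m')")
    case True
    have h: "h = (\<lambda>z. if z > 0 then product_mixture g \<kappa> \<mu> m g' \<kappa>' \<mu>' m' z else 0)"
      using mult_conv_kms_nondegenerate[OF assms(2-5) _ assms(6-9)] True
      by (auto simp: h_def fun_eq_iff)
    interpret prob_space M by (rule assms(1))
    have [measurable]: "X \<in> borel_measurable M" "X' \<in> borel_measurable M"
      using X X' by (auto simp: has_pdf_def dest: distributed_measurable)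
    let ?I = "{0..mix_M \<mu> m} \<times> {0..mix_M \<mu>' m'}"
    have "finite_mixture ?I (\<lambda>p. mix_C \<kappa> \<mu> m (fst p) * mix_C \<kappa>' \<mu>' m' (snd p))
         (\<lambda>p. gamma_gamma (mix_shape \<mu> m (fst p)) (mix_Omega g \<kappa> \<mu> m (fst p))
                     (mix_shape \<mu>' m' (snd p)) (mix_Omega g' \<kappa>' \<mu>' m' (snd p)))
         (distr M borel (\<lambda>\<omega>. X \<omega> * X' \<omega>))"
    proof (rule finite_mixture_gamma_gamma[OF _ _ _ pdf(2,3,4)])
      show "prob_space (distr M borel (\<lambda>\<omega>. X \<omega> * X' \<omega>))"
        by (rule prob_space_distr) measurable
      show "h z = (if z > 0 then \<Sum>p\<in>?I. mix_C \<kappa> \<mu> m (fst p) * mix_C \<kappa>' \<mu>' m' (snd p) *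
          gamma_gamma_density (mix_shape \<mu> m (fst p)) (mix_Omega g \<kappa> \<mu> m (fst p))
                     (mix_shape \<mu>' m' (snd p)) (mix_Omega g' \<kappa>' \<mu>' m' (snd p)) z else 0)" for z
        by (simp add: h product_mixture_def sum.cartesian_product case_prod_beta)
    qed (use assms mix_shape_pos mix_Omega_pos in auto)
    thus ?thesis using True pdf(1) unfolding h by (simp add: case_prod_beta')
  next
    case False
    define f where "f = mult_conv (?D \<kappa>) (?D' \<kappa>')"
    have "((\<lambda>(k, k'). product_mixture g k \<mu> m g' k' \<mu>' m' z) \<longlongrightarrow> f z)
                  (at (\<kappa>, \<kappa>') within {0<..} \<times> {0<..})" if z: "z > 0" for z
    \<comment> \<open>On the approach set both parameters are positive, so the side conditions of
      \<open>mult_conv_kms_nondegenerate\<close> hold vacuously and the formula equals the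
      convolution there.\<close>
    proof (rule Lim_transform_eventually)
      show "((\<lambda>(k, k'). mult_conv (?D k) (?D' k') z) \<longlongrightarrow> f z) (at (\<kappa>, \<kappa>') within {0<..} \<times> {0<..})"
        unfolding f_def by (rule mult_conv_kms_tendsto[OF assms(2,4,5,6,8,9) z assms(3,7)])
      show "\<forall>\<^sub>F p in at (\<kappa>, \<kappa>') within {0<..} \<times> {0<..}.
          (case p of (k, k') \<Rightarrow> mult_conv (?D k) (?D' k') z) =
          (case p of (k, k') \<Rightarrow> product_mixture g k \<mu> m g' k' \<mu>' m' z)"
        unfolding eventually_at_filter
        by (rule always_eventually) (use assms z in \<open>auto intro!: mult_conv_kms_nondegenerate\<close>)
    qed
    moreover have "has_pdf M (\<lambda>\<omega>. X \<omega> * X' \<omega>) (\<lambda>z. if z > 0 then f z else 0)"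
      using pdf(1) unfolding h_def f_def .
    ultimately show ?thesis using False by auto
  qed
qed

end
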